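(* Let $G$ be a series-parallel graph with vertex set $[n]$. The constant terms of the facet-defining hyperplanes of $\operatorname{cut}^{\pm1}(G)$ characterize the ranks of extremal rays of $\mathbb{S}^n_{\succeq0}(G)$. These ranks are $1$ and $m-2$ where $C_m$ is any chordless cycle in $G$. Moreover, the sparsity order of $G$ is $p^*-2$, where $p^*$ is the length of the largest chordless cycle in $G$.
   Context: A graph is series-parallel if it has no $K_4$ minor, where $K_4$ is the complete graph on $4$ vertices and a minor of a graph is a graph obtained from it by a sequence of edge deletions, edge contractions and vertex deletions. $C_m$ denotes the cycle on $m$ vertices; a chordless cycle of $G$ is a cycle subgraph of $G$ that is an induced subgraph. $[n]=\{1,\dots,n\}$ and $E$ is the edge set of $G$. $\mathbb{S}^n_{\succeq0}(G)$ is the closed convex cone of real symmetric positive semidefinite $n\times n$ matrices $X$ with $X_{ij}=0$ for all $i\neq j$ with $\{i,j\}\notin E$. The rank of an extremal ray of this cone is the rank of any nonzero matrix lying on it. The sparsity order of $G$ is the maximum rank of an extremal ray of $\mathbb{S}^n_{\succeq0}(G)$. For $U\subset[n]$, the cutset $\delta(U)\subset E$ is the set of edges with exactly one endpoint in $U$; it is assigned the vector in $\{\pm1\}^E$ whose $e$-th coordinate is $-1$ if and only if $e\in\delta(U)$. The cut polytope $\operatorname{cut}^{\pm1}(G)\subset\mathbb{R}^E$ is the convex hull of all these vectors. The constant term of a facet-defining hyperplane $\langle\alpha,x\rangle=b$ is $b$. Here the hyperplanes are normalized as in the theorem of Barahona and Mahjoub: for a graph $G$ without $K_5$ minors (in particular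 a series-parallel one), $\operatorname{cut}^{\pm1}(G)$ is defined by the inequalities $-1\le x_e\le 1$ for all $e\in E$ and $\sum_{e\in E(C_m)\setminus F}x_e-\sum_{e\in F}x_e\le m-2$ for all chordless cycles $C_m$ of $G$ and all odd-cardinality subsets $F\subset E(C_m)$; the facet-defining hyperplanes are taken in the corresponding forms $\pm x_e=1$ and $\sum_{e\in E(C_m)\setminus F}x_e-\sum_{e\in F}x_e=m-2$. "Characterize" means that each constant term $b$ is the rank of an extremal ray of $\mathbb{S}^n_{\succeq0}(G)$ and that all possible ranks of extremal rays are given in this way. *)

theory Defs
  imports "HOL-Analysis.Analysis"
begin

section \<open>Simple graphs and minors\<close>

text \<open>
  A graph is a pair of a vertex set and a set of edges, each edge being a two-element set
  of vertices.
\<close>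

type_synonym 'a graph = "'a set \<times> 'a set set"

definition simple_graph :: "'a graph \<Rightarrow> bool" where
  "simple_graph G \<longleftrightarrow> (\<forall>e\<in>snd G. e \<subseteq> fst G \<and> card e = 2)"

definition all_pairs :: "'a set \<Rightarrow> 'a set set" where
  "all_pairs V = {e. e \<subseteq> V \<and> card e = 2}"

text \<open>
  Contracting the edge \<open>{u, v}\<close> merges \<open>v\<close> into \<open>u\<close>, so that every minor lives on a subset of
  the original vertices; parallel edges that arise are identified since edges form a set.
\<close>

inductive has_minor :: "'a graph \<Rightarrow> 'a graph \<Rightarrow> bool" for G :: "'a graph" where
  minor_refl: "has_minor G G"
| minor_delete_edge: "has_minor G (V, D) \<Longrightarrow> e \<in> D \<Longrightarrow> has_minor G (V, D - {e})"
| minor_delete_vertex: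
    "has_minor G (V, D) \<Longrightarrow> v \<in> V \<Longrightarrow> has_minor G (V - {v}, {e \<in> D. v \<notin> e})"
| minor_contract_edge:
    "has_minor G (V, D) \<Longrightarrow> {u, v} \<in> D \<Longrightarrow> u \<noteq> v \<Longrightarrow>
     has_minor G (V - {v}, (\<lambda>e. (\<lambda>x. if x = v then u else x) ` e) ` (D - {{u, v}}))"

definition series_parallel :: "'a graph \<Rightarrow> bool" where
  "series_parallel G \<longleftrightarrow> \<not> (\<exists>V. card V = 4 \<and> has_minor G (V, all_pairs V))"


section \<open>Chordless cycles\<close>

definition cycle_edges :: "'a list \<Rightarrow> 'a set set" where
  "cycle_edges vs = {{vs ! i, vs ! (Suc i mod length vs)} | i. i < length vs}"

text \<open>
  The vertex list enumerates the cycle in cyclic order. The first three conditions say that it is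
  a cycle subgraph, the last one that this subgraph is induced. Triangles are chordless.
\<close>

definition chordless_cycle :: "'a set set \<Rightarrow> 'a list \<Rightarrow> bool" where
  "chordless_cycle E vs \<longleftrightarrow>
     3 \<le> length vs \<and> distinct vs \<and> cycle_edges vs \<subseteq> E \<and>
     {e \<in> E. e \<subseteq> set vs} = cycle_edges vs"


section \<open>The cone of positive semidefinite matrices with sparsity pattern\<close>

definition psd_cone :: "'n::finite set set \<Rightarrow> (real^'n^'n) set" where
  "psd_cone E = {X. transpose X = X \<and> (\<forall>x. 0 \<le> x \<bullet> (X *v x)) \<and>
                    (\<forall>i j. i \<noteq> j \<and> {i, j} \<notin> E \<longrightarrow> X $ i $ j = 0)}"

definition extremal_ray :: "'a::real_vector set \<Rightarrow> 'a set \<Rightarrow> bool" where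
  "extremal_ray K R \<longleftrightarrow> (\<exists>x. x \<noteq> 0 \<and> R = {t *\<^sub>R x | t. 0 \<le> t}) \<and> R face_of K"

definition extremal_ranks :: "'n::finite set set \<Rightarrow> nat set" where
  "extremal_ranks E = {rank X | X R. extremal_ray (psd_cone E) R \<and> X \<in> R \<and> X \<noteq> 0}"

definition sparsity_order :: "'n::finite set set \<Rightarrow> nat" where
  "sparsity_order E = Max (extremal_ranks E)"


section \<open>The cut polytope\<close>

definition cutset :: "'a set set \<Rightarrow> 'a set \<Rightarrow> 'a set set" where
  "cutset E U = {e \<in> E. card (e \<inter> U) = 1}"

text \<open>
  The space \<open>\<real>\<^sup>E\<close> is embedded as the coordinate subspace of \<open>real ^ ('n set)\<close> of the vectors
  vanishing at every index outside \<open>E\<close>. Faces and facets do not depend on the ambient space, and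
  all normal vectors used below lie in this subspace.
\<close>

definition cut_vector :: "'n::finite set set \<Rightarrow> 'n set \<Rightarrow> real ^ ('n set)" where
  "cut_vector E U = (\<chi> e. if e \<notin> E then 0 else if e \<in> cutset E U then - 1 else 1)"

definition cut_polytope :: "'n::finite set set \<Rightarrow> (real ^ ('n set)) set" where
  "cut_polytope E = convex hull (range (cut_vector E))"

text \<open>
  The pairs \<open>(\<alpha>, b)\<close> of the inequalities \<open>\<alpha> \<bullet> x \<le> b\<close> in the theorem of Barahona and Mahjoub: the
  edge inequalities and the inequalities of the chordless cycles.
\<close>

definition edge_inequality :: "'n::finite set set \<Rightarrow> real ^ ('n set) \<Rightarrow> real \<Rightarrow> bool" where
  "edge_inequality E \<alpha> b \<longleftrightarrow> (\<exists>e\<in>E. \<alpha> = axis e 1 \<or> \<alpha> = - axis e 1) \<and> b = 1"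

definition cycle_inequality :: "'n::finite set set \<Rightarrow> real ^ ('n set) \<Rightarrow> real \<Rightarrow> bool" where
  "cycle_inequality E \<alpha> b \<longleftrightarrow>
     (\<exists>vs F. chordless_cycle E vs \<and> F \<subseteq> cycle_edges vs \<and> odd (card F) \<and>
        \<alpha> = (\<Sum>e\<in>cycle_edges vs - F. axis e 1) - (\<Sum>e\<in>F. axis e 1) \<and>
        b = real (length vs) - 2)"

definition facet_defining :: "'a::euclidean_space set \<Rightarrow> 'a \<Rightarrow> real \<Rightarrow> bool" where
  "facet_defining P \<alpha> b \<longleftrightarrow> P \<subseteq> {x. \<alpha> \<bullet> x \<le> b} \<and> (P \<inter> {x. \<alpha> \<bullet> x = b}) facet_of P"

definition facet_constant_terms :: "'n::finite set set \<Rightarrow> real set" where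
  "facet_constant_terms E =
     {b. \<exists>\<alpha>. (edge_inequality E \<alpha> b \<or> cycle_inequality E \<alpha> b) \<and>
             facet_defining (cut_polytope E) \<alpha> b}"

end

theory Submission
  imports Defs
begin

text \<open>
  Ranks. A series-parallel graph has a vertex \<open>v\<close> of degree at most two. If its neighbours are
  adjacent, an extremal matrix meeting \<open>v\<close> is proportional to the rank one term split off by the
  Schur complement at \<open>v\<close>. If they are two nonadjacent vertices \<open>u\<close> and \<open>w\<close>, the matrix is a
  combination of that term and of an extremal matrix for the minor in which \<open>v\<close> is replaced by the
  edge \<open>uw\<close>, so each such step lengthens the supporting chordless cycle by one and the rank by at
  most one. Conversely, a matrix with cyclic pattern and nonzero edge entries has corank at most two
  on the cycle, and an explicit extremal matrix of rank \<open>m - 2\<close> exists on every \<open>C\<^sub>m\<close>.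

  Facets. Only the existence of a facet for each constant is needed, not the linear description of
  the cut polytope. For a chordless cycle take \<open>F\<close> to be a single edge: the cuts on the hyperplane
  meet the cycle in an arc, and their differences span a space of codimension one. The constant \<open>1\<close>
  comes from a triangle or, in the absence of triangles, from an edge.
\<close>


section \<open>Series-parallel graphs have a vertex of degree at most two\<close>

text \<open>The Schur complement at \<open>v\<close> need not be extremal, so the elimination step
  cannot simply recurse on it. One extremal summand with the right sign at the fill-in entry is
  enough, and it exists because the slice of the cone by trace one is compact. The induction
  therefore yields only the upper bound m - 2 for the rank, together with a chordless cycle that
  contains the support. The exact values come from a second argument on that cycle: either some
  support vertex misses the entry to its successor, which forces rank one, or all entries along the
  cycle are nonzero and the corank bound closes the gap. The upper bound for the explicit matrix on
  C_m comes from the same induction, applied to the cycle as a graph of its own.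

  Equality of constants and ranks is claimed for graphs with an edge: without edges the cut polytope
  is a point and has no facets, while rank one still occurs.\<close>

definition nbrs :: "'a set set \<Rightarrow> 'a \<Rightarrow> 'a set" where
  "nbrs E x = {y. {x, y} \<in> E}"

definition contract :: "'a set set \<Rightarrow> 'a \<Rightarrow> 'a \<Rightarrow> 'a set set" where
  "contract E u v = (\<lambda>e. (\<lambda>x. if x = v then u else x) ` e) ` (E - {{u, v}})"

section \<open>Minors compose; subgraphs are minors\<close>

lemma has_minor_trans:
  assumes "has_minor H K" "has_minor G H"
  shows "has_minor G K"
  using assms by (induction rule: has_minor.induct) (blast intro: has_minor.intros)+

lemma series_parallel_minor:
  assumes "series_parallel G" "has_minor G H"
  shows "series_parallel H"
  using assms has_minor_trans unfolding series_parallel_def by blast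

lemma has_minor_delete_edges:
  assumes "finite D" "D \<subseteq> E"
  shows "has_minor (V, E) (V, E - D)"
  using assms
proof (induction D rule: finite_induct)
  case empty
  show ?case by (simp add: minor_refl)
next
  case (insert e D)
  then have "has_minor (V, E) (V, E - D)" "e \<in> E - D" by auto
  then have "has_minor (V, E) (V, E - D - {e})" by (rule minor_delete_edge)
  moreover have "E - D - {e} = E - insert e D" by auto
  ultimately show ?case by simp
qed

lemma has_minor_delete_vertices:
  assumes "finite W" "W \<subseteq> V"
  shows "has_minor (V, E) (V - W, {e \<in> E. e \<inter> W = {}})"
  using assms
proof (induction W rule: finite_induct)
  case empty
  show ?case by (simp add: minor_refl)
next
  case (insert v W)
  then have "has_minor (V, E) (V - W, {e \<in> E. e \<inter> W = {}})" "v \<in> V - W" by auto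
  from minor_delete_vertex[OF this] show ?case
    by (rule arg_cong[where f = "has_minor (V, E)", THEN iffD1, rotated]) auto
qed

lemma has_minor_subgraph:
  assumes "finite V" "finite E" "W \<subseteq> V" "D \<subseteq> E" "\<And>e. e \<in> D \<Longrightarrow> e \<subseteq> W"
  shows "has_minor (V, E) (W, D)"
proof -
  let ?E = "{e \<in> E. e \<inter> (V - W) = {}}"
  have "has_minor (V, E) (V - (V - W), ?E)"
    using assms by (intro has_minor_delete_vertices) auto
  moreover have "has_minor (V - (V - W), ?E) (V - (V - W), ?E - (?E - D))"
    using assms by (intro has_minor_delete_edges) auto
  ultimately have "has_minor (V, E) (V - (V - W), ?E - (?E - D))"
    using has_minor_trans by blast
  moreover have "V - (V - W) = W" "?E - (?E - D) = D" using assms by auto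
  ultimately show ?thesis by simp
qed

lemma simple_graph_pair_neq:
  "simple_graph (V, E) \<Longrightarrow> {x, y} \<in> E \<Longrightarrow> x \<noteq> y"
  by (force simp: simple_graph_def)

lemma simple_graph_pair_mem:
  "simple_graph (V, E) \<Longrightarrow> {x, y} \<in> E \<Longrightarrow> x \<in> V \<and> y \<in> V"
  by (force simp: simple_graph_def)

lemma simple_graphE:
  assumes "simple_graph (V, E)" "e \<in> E"
  obtains x y where "e = {x, y}" "x \<noteq> y" "x \<in> V" "y \<in> V"
proof -
  have "card e = 2" "e \<subseteq> V" using assms by (auto simp: simple_graph_def)
  then show ?thesis using that by (auto simp: card_2_iff)
qed

lemma nbrs_sym: "y \<in> nbrs E x \<longleftrightarrow> x \<in> nbrs E y"
  by (simp add: nbrs_def insert_commute)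

lemma nbrs_irrefl: "simple_graph (V, E) \<Longrightarrow> x \<notin> nbrs E x"
  unfolding nbrs_def using simple_graph_pair_neq[of V E x x] by blast

lemma nbrs_subset: "simple_graph (V, E) \<Longrightarrow> nbrs E x \<subseteq> V"
  by (auto simp: nbrs_def dest: simple_graph_pair_mem)

lemma contract_iff:
  assumes G: "simple_graph (V, E)" and uv: "u \<noteq> v"
  shows "{x, y} \<in> contract E u v \<longleftrightarrow> x \<noteq> v \<and> y \<noteq> v \<and>
    ({x, y} \<in> E \<or> x = u \<and> y \<noteq> u \<and> {v, y} \<in> E \<or> y = u \<and> x \<noteq> u \<and> {v, x} \<in> E)"
    (is "_ \<longleftrightarrow> ?R")
proof
  assume "{x, y} \<in> contract E u v"
  then obtain e where e: "e \<in> E" "e \<noteq> {u, v}" "{x, y} = (\<lambda>x. if x = v then u else x) ` e"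
    by (auto simp: contract_def)
  obtain a b where ab: "e = {a, b}" "a \<noteq> b" using G e(1) by (rule simple_graphE)
  have xy: "{x, y} = {if a = v then u else a, if b = v then u else b}"
    using e(3) unfolding ab image_insert image_empty .
  consider "a = v" | "b = v" | "a \<noteq> v" "b \<noteq> v" by blast
  then show ?R
  proof cases
    case 1
    then have "{x, y} = {u, b}" "b \<noteq> v" "{v, b} \<in> E" "b \<noteq> u" using xy ab e by auto
    then show ?thesis using uv by (auto simp: doubleton_eq_iff)
  next
    case 2
    then have "{x, y} = {u, a}" "a \<noteq> v" "{v, a} \<in> E" "a \<noteq> u"
      using xy ab e by (auto simp: insert_commute)
    then show ?thesis using uv by (auto simp: doubleton_eq_iff)
  next
    case 3
    then have "{x, y} = e" using xy ab by simp
    moreover from this have "x \<noteq> v" "y \<noteq> v" using 3 ab by auto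
    ultimately show ?thesis using e(1) by simp
  qed
next
  assume R: ?R
  have "{x, y} \<in> contract E u v" if "{x, y} \<in> E" "x \<noteq> v" "y \<noteq> v" for x y
    using that unfolding contract_def
    by (intro image_eqI[where x = "{x, y}"]) (auto simp: doubleton_eq_iff)
  moreover have "{u, y} \<in> contract E u v" if "{v, y} \<in> E" "y \<noteq> u" for y
    using that uv simple_graph_pair_neq[OF G that(1)] unfolding contract_def
    by (intro image_eqI[where x = "{v, y}"]) (auto simp: doubleton_eq_iff)
  ultimately show "{x, y} \<in> contract E u v" using R by (metis insert_commute)
qed

lemma has_minor_contract:
  "{u, v} \<in> E \<Longrightarrow> u \<noteq> v \<Longrightarrow> has_minor (V, E) (V - {v}, contract E u v)"
  unfolding contract_def by (rule minor_contract_edge[OF minor_refl])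

lemma simple_graph_contract:
  assumes G: "simple_graph (V, E)" and uv: "u \<noteq> v" "u \<in> V"
  shows "simple_graph (V - {v}, contract E u v)"
  unfolding simple_graph_def
proof
  fix e assume e: "e \<in> snd (V - {v}, contract E u v)"
  then obtain d where d: "d \<in> E" "e = (\<lambda>x. if x = v then u else x) ` d"
    by (auto simp: contract_def)
  obtain a b where ab: "d = {a, b}" using G d(1) by (rule simple_graphE)
  obtain x y where xy: "e = {x, y}" using d(2) unfolding ab image_insert image_empty by blast
  have "{x, y} \<in> contract E u v" using e xy by simp
  then show "e \<subseteq> fst (V - {v}, contract E u v) \<and> card e = 2"
    unfolding contract_iff[OF G uv(1)] using xy uv
    by (auto dest: simple_graph_pair_mem[OF G] simple_graph_pair_neq[OF G])
qed

lemma simple_graph_delete: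
  assumes "simple_graph (V, E)"
  shows "simple_graph (V - {v}, {e \<in> E. v \<notin> e})"
  using assms by (auto simp: simple_graph_def)

text \<open>The degree counts below rest on these formulas: a third vertex loses degree under the
  contraction only if it is adjacent to both ends of the contracted edge, and then it loses exactly
  one.\<close>

lemma nbrs_contract:
  assumes G: "simple_graph (V, E)" and uv: "{u, v} \<in> E"
  shows "nbrs (contract E u v) u = nbrs E u \<union> nbrs E v - {u, v}"
    and "x \<noteq> u \<Longrightarrow> x \<noteq> v \<Longrightarrow> v \<notin> nbrs E x \<Longrightarrow> nbrs (contract E u v) x = nbrs E x"
    and "x \<noteq> u \<Longrightarrow> x \<noteq> v \<Longrightarrow> v \<in> nbrs E x \<Longrightarrow>
      nbrs (contract E u v) x = insert u (nbrs E x - {v})"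
  using simple_graph_pair_neq[OF G uv] nbrs_irrefl[OF G]
  unfolding nbrs_def contract_iff[OF G simple_graph_pair_neq[OF G uv]]
  by (auto simp: insert_commute)

lemma nbrs_delete:
  "x \<noteq> v \<Longrightarrow> nbrs {e \<in> E. v \<notin> e} x = nbrs E x - {v}"
  by (auto simp: nbrs_def)

lemma K4_minor_of_clique:
  assumes "finite V" "finite E" "card W = 4" "W \<subseteq> V"
    and "\<And>x y. x \<in> W \<Longrightarrow> y \<in> W \<Longrightarrow> x \<noteq> y \<Longrightarrow> {x, y} \<in> E"
  shows "\<not> series_parallel (V, E)"
proof -
  have "all_pairs W \<subseteq> E" using assms(5) by (auto simp: all_pairs_def card_2_iff)
  then have "has_minor (V, E) (W, all_pairs W)"
    using assms by (intro has_minor_subgraph) (auto simp: all_pairs_def)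
  then show ?thesis using assms(3) by (auto simp: series_parallel_def)
qed

lemma card_3_obtain:
  assumes "card S = 3" "a \<in> S" "b \<in> S" "a \<noteq> b"
  obtains c where "S = {a, b, c}" "c \<noteq> a" "c \<noteq> b"
proof -
  have "card (S - {a, b}) = 1" using assms by (simp add: card_Diff_subset)
  then obtain c where "S - {a, b} = {c}" by (auto simp: card_1_singleton_iff)
  then show ?thesis using assms that[of c] by auto
qed

text \<open>
  The exceptional vertex makes the induction work: contracting an edge at \<open>r\<close> does no harm to \<open>r\<close>,
  so it can only fail because of a common neighbour of degree exactly three.
\<close>

lemma not_series_parallel_of_degrees:
  fixes E :: "'a::finite set set"
  assumes "simple_graph (V, E)" "2 \<le> card V" "r \<in> V"
    and "\<And>x. x \<in> V - {r} \<Longrightarrow> 3 \<le> card (nbrs E x)"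
  shows "\<not> series_parallel (V, E)"
  using assms
proof (induction "card V" arbitrary: V E r rule: less_induct)
  case less
  note G = less.prems(1) and r = less.prems(3) and deg = less.prems(4)
  note irr = nbrs_irrefl[OF G] and sub = nbrs_subset[OF G]
  \<comment> \<open>The induction hypothesis for a proper minor in which only \<open>s\<close> may
    have degree below three. The vertex \<open>x\<close> witnesses that at least two vertices
    remain.\<close>
  have smaller: "\<not> series_parallel (V, E)"
    if "has_minor (V, E) (W, D)" "W \<subseteq> V" "W \<noteq> V" "simple_graph (W, D)" "s \<in> W"
      "x \<in> W" "x \<noteq> s" "\<And>x. x \<in> W - {s} \<Longrightarrow> 3 \<le> card (nbrs D x)" for W D s x
  proof -
    have "card W < card V" using that(2,3) by (intro psubset_card_mono) auto
    moreover have "2 \<le> card W"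
      using card_mono[of W "{x, s}"] that(5-7) by simp
    ultimately show ?thesis
      using less.hyps[OF _ that(4) _ that(5,8)] that(1) series_parallel_minor by blast
  qed
  have outside: "\<exists>y. y \<in> nbrs E x \<and> y \<notin> F" if "x \<in> V - {r}" "card F \<le> 2" for x F
  proof (rule ccontr)
    assume "\<not> ?thesis"
    then have "nbrs E x \<subseteq> F" by auto
    then have "card (nbrs E x) \<le> 2" using that(2) card_mono[of F "nbrs E x"] by simp
    then show False using deg[OF that(1)] by simp
  qed
  show ?case
  proof (cases "nbrs E r = {}")
    \<comment> \<open>An isolated \<open>r\<close> can be deleted without changing any other degree,
      and any other vertex takes over the exceptional role.\<close>
    case True
    have "V \<noteq> {r}" using less.prems(2) by auto
    then obtain s where s: "s \<in> V - {r}" using r by auto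
    obtain y where y: "y \<in> nbrs E s" using outside[OF s, of "{}"] by auto
    have yr: "y \<noteq> r" using y True nbrs_sym[of y E s] by auto
    show ?thesis
    proof (rule smaller[where W = "V - {r}" and s = s and x = y])
      show "has_minor (V, E) (V - {r}, {e \<in> E. r \<notin> e})"
        using r by (intro minor_delete_vertex minor_refl)
      show "simple_graph (V - {r}, {e \<in> E. r \<notin> e})" using G by (rule simple_graph_delete)
      fix z assume z: "z \<in> V - {r} - {s}"
      then have "nbrs {e \<in> E. r \<notin> e} z = nbrs E z"
        using True nbrs_sym[of r E z] by (auto simp: nbrs_delete)
      then show "3 \<le> card (nbrs {e \<in> E. r \<notin> e} z)" using deg z by simp
    qed (use r s y yr irr sub in auto)
  next
    case False
    \<comment> \<open>Contracting \<open>rv\<close> into \<open>r\<close> lowers the degree of a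
      vertex other than \<open>r\<close> only if it is a common neighbour of \<open>r\<close> and
      \<open>v\<close>; so the contraction fails only at a common neighbour of degree exactly
      three.\<close>
    have common: "\<not> series_parallel (V, E) \<or>
        (\<exists>w. w \<in> nbrs E r \<and> w \<in> nbrs E v \<and> card (nbrs E w) = 3)" if v: "v \<in> nbrs E r" for v
    proof (rule ccontr)
      assume *: "\<not> ?thesis"
      have vr: "v \<noteq> r" "v \<in> V" and E: "{r, v} \<in> E" using v irr sub by (auto simp: nbrs_def)
      obtain x where x: "x \<in> nbrs E v" "x \<noteq> r" using outside[of v "{r}"] vr by auto
      have "\<not> series_parallel (V, E)"
      proof (rule smaller[where W = "V - {v}" and s = r and x = x])
        show "has_minor (V, E) (V - {v}, contract E r v)" using E vr by (intro has_minor_contract) auto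
        show "simple_graph (V - {v}, contract E r v)" using G vr r by (intro simple_graph_contract) auto
        fix z assume z: "z \<in> V - {v} - {r}"
        show "3 \<le> card (nbrs (contract E r v) z)"
        proof (cases "v \<in> nbrs E z")
          case False
          then show ?thesis using nbrs_contract(2)[OF G E, of z] z deg by auto
        next
          case True
          then have eq: "nbrs (contract E r v) z = insert r (nbrs E z - {v})"
            using nbrs_contract(3)[OF G E, of z] z by auto
          show ?thesis
          proof (cases "r \<in> nbrs E z")
            case rz: True
            then have "card (nbrs E z) \<noteq> 3" using * True nbrs_sym[of z E] by auto
            then have "4 \<le> card (nbrs E z)" using deg[of z] z by simp
            then show ?thesis using True rz vr unfolding eq by (simp add: insert_absorb)
          next
            case rz: False
            then show ?thesis using True vr deg[of z] z unfolding eq by simp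
          qed
        qed
      qed (use r x vr irr sub in auto)
      then show False using * by simp
    qed
    show ?thesis
    proof (rule ccontr)
      assume sp: "\<not> \<not> series_parallel (V, E)"
      \<comment> \<open>Using \<open>common\<close> at \<open>v\<close> and then at the vertex
        \<open>w\<close> it produces gives a triangle \<open>r\<close>, \<open>w\<close>,
        \<open>w'\<close> in which \<open>w\<close> and \<open>w'\<close> both have degree three.
        Their third neighbours \<open>a\<close> and \<open>b\<close> decide the rest.\<close>
      obtain v where "v \<in> nbrs E r" using False by auto
      then obtain w where w: "w \<in> nbrs E r" "card (nbrs E w) = 3" using common[of v] sp by auto
      then obtain w' where w': "w' \<in> nbrs E r" "w' \<in> nbrs E w" "card (nbrs E w') = 3"
        using common[of w] sp by auto
      have neq: "r \<noteq> w" "r \<noteq> w'" "w \<noteq> w'" and V: "w \<in> V" "w' \<in> V"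
        using w w' irr sub by auto
      have sym: "r \<in> nbrs E w" "r \<in> nbrs E w'" "w \<in> nbrs E w'"
        using w w' by (auto simp: nbrs_sym)
      obtain a where a: "nbrs E w = {r, w', a}" "a \<noteq> r" "a \<noteq> w'"
        using card_3_obtain[OF w(2) sym(1) w'(2) neq(2)] .
      obtain b where b: "nbrs E w' = {r, w, b}" "b \<noteq> r" "b \<noteq> w"
        using card_3_obtain[OF w'(3) sym(2) sym(3) neq(1)] .
      have aw: "a \<noteq> w" "b \<noteq> w'" and aV: "a \<in> V" "b \<in> V"
        using a b irr[of w] irr[of w'] sub[of w] sub[of w'] by auto
      have Eww: "{w, w'} \<in> E" using w'(2) by (simp add: nbrs_def)
      show False
      proof (cases "a = b")
        \<comment> \<open>Contracting \<open>ww'\<close> merges them into a vertex with the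
          neighbours \<open>r\<close>, \<open>a\<close>, \<open>b\<close>. The only common neighbour
          of \<open>w\<close> and \<open>w'\<close> is \<open>r\<close>, whose degree is
          unconstrained.\<close>
        case False
        have "\<not> series_parallel (V, E)"
        proof (rule smaller[where W = "V - {w'}" and s = r and x = w])
          show "has_minor (V, E) (V - {w'}, contract E w w')"
            using Eww neq by (intro has_minor_contract) auto
          show "simple_graph (V - {w'}, contract E w w')"
            using G V neq by (intro simple_graph_contract) auto
          fix z assume z: "z \<in> V - {w'} - {r}"
          consider "z = w" | "z \<noteq> w" "w' \<notin> nbrs E z" | "z \<noteq> w" "w' \<in> nbrs E z" by blast
          then show "3 \<le> card (nbrs (contract E w w') z)"
          proof cases
            case 1
            have "nbrs (contract E w w') w = {r, a, b}"
              using nbrs_contract(1)[OF G Eww] a b neq aw False by auto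
            then show ?thesis using 1 a b False by simp
          next
            case 2
            then show ?thesis using nbrs_contract(2)[OF G Eww, of z] z deg by auto
          next
            case 3
            then have "z = b" using b z nbrs_sym[of w' E z] by auto
            then have "w \<notin> nbrs E z" using a False b aw nbrs_sym[of w E z] by auto
            then show ?thesis using nbrs_contract(3)[OF G Eww, of z] 3 z deg[of z] by auto
          qed
        qed (use r V neq in auto)
        then show False using sp by simp
      next
        \<comment> \<open>Now \<open>r\<close>, \<open>w\<close>, \<open>w'\<close>,
          \<open>a\<close> span a complete graph up to the edge \<open>ra\<close>. Deleting
          \<open>w'\<close> and contracting \<open>rw\<close> replaces this piece by the edge
          \<open>ra\<close>; only \<open>a\<close> and \<open>r\<close> can lose degree.\<close>
        case ab: True
        let ?V = "V - {w'}" and ?E = "{e \<in> E. w' \<notin> e}"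
        let ?V1 = "?V - {w}" and ?E1 = "contract ?E r w"
        have G0: "simple_graph (?V, ?E)" using G by (rule simple_graph_delete)
        have Erw: "{r, w} \<in> ?E" using w(1) neq by (auto simp: nbrs_def)
        have G1: "simple_graph (?V1, ?E1)"
          using G0 neq r by (intro simple_graph_contract) auto
        have "has_minor (V, E) (?V, ?E)" using V by (intro minor_delete_vertex minor_refl)
        moreover have "has_minor (?V, ?E) (?V1, ?E1)"
          using Erw neq by (intro has_minor_contract) auto
        ultimately have m1: "has_minor (V, E) (?V1, ?E1)" using has_minor_trans by blast
        have nw: "w' \<in> nbrs E a" "w \<in> nbrs E a" using a b ab nbrs_sym[of w' E a] nbrs_sym[of w E a] by auto
        have n1a: "nbrs ?E1 a = insert r (nbrs E a - {w, w'})"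
          using nbrs_contract(3)[OF G0 Erw, of a] a aw nw neq
          by (auto simp: nbrs_delete)
        have n1: "nbrs ?E1 z = nbrs E z" if "z \<in> V" "z \<noteq> r" "z \<noteq> w" "z \<noteq> w'" "z \<noteq> a" for z
        proof -
          have "w \<notin> nbrs E z" "w' \<notin> nbrs E z"
            using a b ab that nbrs_sym[of w E z] nbrs_sym[of w' E z] by auto
          then show ?thesis using nbrs_contract(2)[OF G0 Erw, of z] that by (auto simp: nbrs_delete)
        qed
        have K4: False if "has_minor (V, E) (W, D)" "{r, w, w', a} \<subseteq> W"
          "a \<in> nbrs D r" "\<And>e. e \<in> E \<Longrightarrow> e \<subseteq> {r, w, w', a} \<Longrightarrow> e \<in> D" for W D
        proof -
          have "a \<in> nbrs E w" "a \<in> nbrs E w'" using a b ab by auto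
          then have "{r, w} \<in> E" "{r, w'} \<in> E" "{w, w'} \<in> E" "{w, a} \<in> E" "{w', a} \<in> E"
            using w(1) w'(1,2) by (simp_all add: nbrs_def)
          then have "{r, w} \<in> D" "{r, w'} \<in> D" "{w, w'} \<in> D" "{w, a} \<in> D" "{w', a} \<in> D"
            by (auto intro!: that(4))
          moreover have "{r, a} \<in> D" using that(3) by (simp add: nbrs_def insert_commute)
          moreover have "r \<in> W" "w \<in> W" "w' \<in> W" "a \<in> W" using that(2) by auto
          moreover have "card {r, w, w', a} = 4" using neq a(2,3) aw by simp
          ultimately have "\<not> series_parallel (W, D)"
            by (intro K4_minor_of_clique[of W D "{r, w, w', a}"])
              (auto simp: insert_commute)
          then show False using series_parallel_minor[of "(V, E)" "(W, D)"] that(1) sp by blast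
        qed
        show False
        proof (cases "a \<in> nbrs E r")
          case True
          then show False using K4[OF minor_refl] r V aV by auto
        next
          case ra: False
          show False
          proof (cases "card (nbrs E a) = 3")
            \<comment> \<open>In the minor \<open>a\<close> trades the two neighbours
              \<open>w\<close>, \<open>w'\<close> for the new neighbour \<open>r\<close>, so degree
              at least four becomes degree at least three.\<close>
            case False
            have "\<not> series_parallel (V, E)"
            proof (rule smaller[OF m1, where s = r and x = a])
              fix z assume z: "z \<in> ?V1 - {r}"
              show "3 \<le> card (nbrs ?E1 z)"
              proof (cases "z = a")
                case True
                have "r \<notin> nbrs E a" using ra nbrs_sym[of r E a] by auto
                moreover have "4 \<le> card (nbrs E a)" using False deg[of a] aV a by auto
                moreover have "card (nbrs E a - {w, w'}) = card (nbrs E a) - 2"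
                  using nw neq by (subst card_Diff_subset) auto
                ultimately show ?thesis using True n1a by simp
              qed (use z n1 deg in auto)
            qed (use V G1 r neq aV a aw in auto)
            then show False using sp by simp
          next
            case True
            obtain y where y: "nbrs E a = {w, w', y}" "y \<noteq> w" "y \<noteq> w'"
              using card_3_obtain[OF True nw(2,1) neq(3)] .
            have ya: "y \<noteq> a" "y \<in> V" "y \<noteq> r"
              using y irr[of a] sub[of a] ra nbrs_sym[of r E a] by auto
            have Eay: "{a, y} \<in> E" using y by (auto simp: nbrs_def)
            show False
            proof (cases "y \<in> nbrs E r")
              \<comment> \<open>Contracting \<open>ay\<close> into \<open>a\<close> turns the path
                from \<open>a\<close> over \<open>y\<close> to \<open>r\<close> into the missing
                edge \<open>ra\<close>.\<close>
              case True
              show False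
              proof (rule K4[where D = "contract E a y"])
                show "has_minor (V, E) (V - {y}, contract E a y)"
                  using Eay ya by (intro has_minor_contract) auto
                show "a \<in> nbrs (contract E a y) r"
                  using nbrs_contract(3)[OF G Eay, of r] True a ya by auto
                fix e assume e: "e \<in> E" "e \<subseteq> {r, w, w', a}"
                obtain p q where pq: "e = {p, q}" using G e(1) by (rule simple_graphE)
                show "e \<in> contract E a y" using e pq y ya
                  by (auto simp: contract_iff[OF G ya(1)[symmetric]])
              qed (use r V aV ya y in auto)
            next
              \<comment> \<open>In the first minor \<open>a\<close> has only the neighbours
                \<open>r\<close> and \<open>y\<close>. Contracting it into \<open>r\<close> as well
                costs \<open>y\<close> nothing: it exchanges \<open>a\<close> for \<open>r\<close>,
                which was not its neighbour.\<close>
              case ry: False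
              let ?E2 = "contract ?E1 r a"
              have "r \<in> nbrs ?E1 a" using n1a by blast
              then have Era: "{r, a} \<in> ?E1" unfolding nbrs_def insert_commute[of r] by blast
              have "has_minor (?V1, ?E1) (?V1 - {a}, ?E2)"
                using Era a by (intro has_minor_contract) auto
              then have m2: "has_minor (V, E) (?V1 - {a}, ?E2)" using m1 has_minor_trans by blast
              have "\<not> series_parallel (V, E)"
              proof (rule smaller[OF m2, where s = r and x = y])
                show "simple_graph (?V1 - {a}, ?E2)"
                  using a r neq by (intro simple_graph_contract[OF G1]) auto
                fix z assume z: "z \<in> ?V1 - {a} - {r}"
                then have nz: "nbrs ?E1 z = nbrs E z" using n1 by auto
                show "3 \<le> card (nbrs ?E2 z)"
                proof (cases "a \<in> nbrs E z")
                  case False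
                  then show ?thesis
                    using nbrs_contract(2)[OF G1 Era, of z] nz z deg by auto
                next
                  case True
                  then have "z = y" using y z nbrs_sym[of a E z] by auto
                  then have "r \<notin> nbrs E z" using ry nbrs_sym[of r E y] by auto
                  then show ?thesis
                    using nbrs_contract(3)[OF G1 Era, of z] nz z deg[of z] True by auto
                qed
              qed (use V r a ya y neq aw in auto)
              then show False using sp by simp
            qed
          qed
        qed
      qed
    qed
  qed
qed

lemma series_parallel_degree_le_2:
  fixes E :: "'a::finite set set"
  assumes G: "simple_graph (V, E)" "series_parallel (V, E)" and "V \<noteq> {}"
  obtains v where "v \<in> V" "card (nbrs E v) \<le> 2"
proof -
  obtain r where r: "r \<in> V" using assms(3) by auto
  have "\<exists>v\<in>V. card (nbrs E v) \<le> 2"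
  proof (rule ccontr)
    assume *: "\<not> ?thesis"
    then have "3 \<le> card (nbrs E x)" if "x \<in> V" for x using that by force
    moreover have "card (nbrs E r) \<le> card V" using nbrs_subset[OF G(1)] by (intro card_mono) auto
    ultimately show False
      using not_series_parallel_of_degrees[OF G(1) _ r] G(2) r by fastforce
  qed
  then show ?thesis using that by blast
qed


section \<open>Positive semidefinite matrices\<close>

definition outer :: "real^'n \<Rightarrow> real^'n^'n" where
  "outer y = (\<chi> i j. y $ i * y $ j)"

text \<open>Nonzero points of extremal rays, described by the order of the cone instead of by faces;
  this is the form in which splittings are tested. \<open>extremal_ranks_eq\<close> leads back to
  rays.\<close>

definition extremal :: "'n::finite set set \<Rightarrow> real^'n^'n \<Rightarrow> bool" where
  "extremal E X \<longleftrightarrow> X \<in> psd_cone E \<and> X \<noteq> 0 \<and>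
     (\<forall>A\<in>psd_cone E. X - A \<in> psd_cone E \<longrightarrow> (\<exists>k. A = k *\<^sub>R X))"

lemma outer_nth [simp]: "outer y $ i $ j = y $ i * y $ j"
  by (simp add: outer_def)

lemma outer_mult: "outer y *v x = (y \<bullet> x) *\<^sub>R y"
  by (simp add: vec_eq_iff matrix_vector_mult_def inner_vec_def sum_distrib_right mult.assoc)
    (simp add: mult.commute mult.left_commute)

text \<open>With the edge set \<open>UNIV\<close> the pattern condition is void, so
  \<open>psd_cone UNIV\<close> is the cone of all positive semidefinite matrices, and
  semidefiniteness can be treated apart from sparsity.\<close>

lemma psd_cone_iff:
  "X \<in> psd_cone E \<longleftrightarrow> X \<in> psd_cone UNIV \<and> (\<forall>i j. i \<noteq> j \<longrightarrow> {i, j} \<notin> E \<longrightarrow> X $ i $ j = 0)"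
  by (auto simp: psd_cone_def)

lemma psd_cone_UNIV_D: "X \<in> psd_cone E \<Longrightarrow> X \<in> psd_cone UNIV"
  by (auto simp: psd_cone_def)

lemma psd_cone_offpattern: "X \<in> psd_cone E \<Longrightarrow> i \<noteq> j \<Longrightarrow> {i, j} \<notin> E \<Longrightarrow> X $ i $ j = 0"
  by (auto simp: psd_cone_def)

lemma psd_cone_sym: "X \<in> psd_cone E \<Longrightarrow> X $ i $ j = X $ j $ i"
  unfolding psd_cone_def by (metis (mono_tags, lifting) mem_Collect_eq transpose_def vec_lambda_beta)

lemma psd_cone_nonneg: "X \<in> psd_cone E \<Longrightarrow> 0 \<le> x \<bullet> (X *v x)"
  by (auto simp: psd_cone_def)

lemma psd_cone_UNIV_I:
  assumes "\<And>i j. X $ i $ j = X $ j $ i" "\<And>x. 0 \<le> x \<bullet> (X *v x)"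
  shows "X \<in> psd_cone UNIV"
  using assms by (auto simp: psd_cone_def transpose_def vec_eq_iff)

lemma psd_cone_mono: "X \<in> psd_cone E \<Longrightarrow> E \<subseteq> E' \<Longrightarrow> X \<in> psd_cone E'"
  by (auto simp: psd_cone_def)

lemma psd_cone_zero: "0 \<in> psd_cone E"
  by (auto simp: psd_cone_def transpose_def vec_eq_iff)

lemma psd_cone_add: "X \<in> psd_cone E \<Longrightarrow> Y \<in> psd_cone E \<Longrightarrow> X + Y \<in> psd_cone E"
  by (auto simp: psd_cone_def transpose_def vec_eq_iff matrix_vector_mult_add_rdistrib
      inner_add_right)

lemma psd_cone_scaleR: "X \<in> psd_cone E \<Longrightarrow> 0 \<le> c \<Longrightarrow> c *\<^sub>R X \<in> psd_cone E"
  by (auto simp: psd_cone_def transpose_def vec_eq_iff scaleR_matrix_vector_assoc[symmetric])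

lemma outer_psd: "outer y \<in> psd_cone UNIV"
  by (rule psd_cone_UNIV_I) (auto simp: outer_mult inner_commute)

lemma psd_cone_bilinear:
  assumes "X \<in> psd_cone E"
  shows "x \<bullet> (X *v y) = y \<bullet> (X *v x)"
proof -
  have "transpose X = X" using assms by (auto simp: psd_cone_def)
  then show ?thesis by (metis dot_lmul_matrix inner_commute transpose_matrix_vector)
qed

lemma psd_Cauchy_Schwarz:
  assumes X: "X \<in> psd_cone E"
  shows "(x \<bullet> (X *v y))\<^sup>2 \<le> (x \<bullet> (X *v x)) * (y \<bullet> (X *v y))"
proof -
  define a b c where "a = x \<bullet> (X *v x)" "b = x \<bullet> (X *v y)" "c = y \<bullet> (X *v y)"
  have q: "0 \<le> s\<^sup>2 * a + 2 * s * t * b + t\<^sup>2 * c" for s t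
    using psd_cone_nonneg[OF X, of "s *\<^sub>R x + t *\<^sub>R y"] psd_cone_bilinear[OF X, of y x]
    by (simp add: a_b_c_def matrix_vector_right_distrib matrix_vector_mult_scaleR inner_add_left
        inner_add_right algebra_simps power2_eq_square)
  have c: "0 \<le> c" using psd_cone_nonneg[OF X] by (simp add: a_b_c_def)
  have "b\<^sup>2 \<le> a * c"
  proof (cases "c = 0")
    case True
    have "b = 0"
    proof (rule ccontr)
      assume "b \<noteq> 0"
      \<comment> \<open>For c = 0 and s = 1 the form is affine in t, and this t gives it the value
        -1.\<close>
      then show False using q[of 1 "- (a + 1) / (2 * b)"] True by (simp add: field_simps)
    qed
    then show ?thesis using True by simp
  next
    case False
    \<comment> \<open>The minimiser of the form for fixed s, scaled to avoid a division: s = c and t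
      = -b.\<close>
    have "0 \<le> c * (a * c - b\<^sup>2)"
      using q[of c "- b"] by (simp add: power2_eq_square algebra_simps)
    then show ?thesis using False c by (simp add: zero_le_mult_iff)
  qed
  then show ?thesis by (simp add: a_b_c_def)
qed

text \<open>Cauchy-Schwarz for \<open>x\<close> against the vector \<open>X *v x\<close>
  itself.\<close>

lemma psd_kernel:
  assumes X: "X \<in> psd_cone E" and "x \<bullet> (X *v x) = 0"
  shows "X *v x = 0"
  using psd_Cauchy_Schwarz[OF X, of "X *v x" x] assms(2) by simp

lemma axis_inner_mult: "axis i 1 \<bullet> (X *v axis j 1) = (X :: real^'n^'n) $ i $ j"
  by (simp add: inner_axis' matrix_vector_mult_basis column_def)

lemma psd_diag_nonneg: "X \<in> psd_cone E \<Longrightarrow> 0 \<le> X $ i $ i"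
  using psd_cone_nonneg[of X E "axis i 1"] by (simp add: axis_inner_mult)

lemma psd_entry_sq: "X \<in> psd_cone E \<Longrightarrow> (X $ i $ j)\<^sup>2 \<le> X $ i $ i * X $ j $ j"
  using psd_Cauchy_Schwarz[of X E "axis i 1" "axis j 1"] by (simp add: axis_inner_mult)

lemma psd_diag_zero:
  assumes "X \<in> psd_cone E" "X $ i $ i = 0"
  shows "X $ i $ j = 0" "X $ j $ i = 0"
  using psd_entry_sq[OF assms(1), of i j] assms psd_cone_sym[OF assms(1), of j i] by auto

lemma psd_nonzero_diag:
  assumes "X \<in> psd_cone E" "X \<noteq> 0"
  obtains i where "0 < X $ i $ i"
proof -
  obtain i j where "X $ i $ j \<noteq> 0" using assms(2) by (auto simp: vec_eq_iff)
  then have "X $ i $ i \<noteq> 0" using psd_diag_zero[OF assms(1)] by blast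
  then show ?thesis using psd_diag_nonneg[OF assms(1), of i] that[of i] by linarith
qed

lemma psd_diag_le:
  assumes "A \<in> psd_cone E" "X - A \<in> psd_cone E'"
  shows "0 \<le> A $ i $ i" "A $ i $ i \<le> X $ i $ i"
  using psd_diag_nonneg[OF assms(1), of i] psd_diag_nonneg[OF assms(2), of i] by simp_all

lemma column_nth: "column v X $ i = X $ i $ v"
  by (simp add: column_def)

text \<open>Cauchy-Schwarz against \<open>axis v 1\<close>, divided by the positive diagonal entry.
  The complement keeps the full matrix size; its row and column \<open>v\<close> vanish.\<close>

lemma psd_Schur_complement:
  assumes X: "X \<in> psd_cone E" and v: "X $ v $ v \<noteq> 0"
  shows "X - (1 / X $ v $ v) *\<^sub>R outer (column v X) \<in> psd_cone UNIV"
proof (rule psd_cone_UNIV_I)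
  fix i j
  show "(X - (1 / X $ v $ v) *\<^sub>R outer (column v X)) $ i $ j =
        (X - (1 / X $ v $ v) *\<^sub>R outer (column v X)) $ j $ i"
    using psd_cone_sym[OF X, of i j] by simp
next
  fix x
  have pos: "0 < X $ v $ v" using v psd_diag_nonneg[OF X, of v] by simp
  have "(x \<bullet> column v X)\<^sup>2 \<le> (x \<bullet> (X *v x)) * X $ v $ v"
    using psd_Cauchy_Schwarz[OF X, of x "axis v 1"]
    by (simp add: axis_inner_mult) (simp add: matrix_vector_mult_basis)
  then have "(x \<bullet> column v X)\<^sup>2 / X $ v $ v \<le> x \<bullet> (X *v x)"
    using pos by (simp add: divide_le_eq)
  then show "0 \<le> x \<bullet> ((X - (1 / X $ v $ v) *\<^sub>R outer (column v X)) *v x)"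
    by (simp add: matrix_vector_mult_diff_rdistrib inner_diff_right scaleR_matrix_vector_assoc[symmetric]
        outer_mult power2_eq_square inner_commute)
qed

section \<open>Extremality in the order of the cone\<close>

lemma extremal_cone: "extremal E X \<Longrightarrow> X \<in> psd_cone E"
  by (simp add: extremal_def)

lemma extremal_nonzero: "extremal E X \<Longrightarrow> X \<noteq> 0"
  by (simp add: extremal_def)

lemma extremalD:
  assumes "extremal E X" "A \<in> psd_cone E" "X - A \<in> psd_cone E" "A \<noteq> 0"
  obtains k where "X = k *\<^sub>R A" "0 < k"
proof -
  obtain k where k: "A = k *\<^sub>R X" using assms by (auto simp: extremal_def)
  obtain i where i: "0 < A $ i $ i" using psd_nonzero_diag[OF assms(2,4)] .
  have "0 \<le> X $ i $ i" using psd_diag_nonneg[OF extremal_cone[OF assms(1)]] .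
  then have "0 < k" using i k by (auto simp: zero_less_mult_iff)
  moreover from this have "X = (1 / k) *\<^sub>R A" using k by simp
  ultimately show ?thesis using that[of "1 / k"] by simp
qed

text \<open>A smaller pattern only removes competitors \<open>A\<close>.\<close>

lemma extremal_subpattern:
  assumes "extremal E X" "X \<in> psd_cone E'" "E' \<subseteq> E"
  shows "extremal E' X"
  using assms psd_cone_mono unfolding extremal_def by blast

text \<open>The rank one Schur term at \<open>v\<close> is supported on \<open>v\<close> and the
  vertices joined to it by nonzero entries of \<open>X\<close>. If these are pairwise adjacent, the
  term respects the pattern and is an admissible summand. Since only nonzero entries count, this
  also applies at a cycle vertex where one of the two edge entries vanishes.\<close>

lemma extremal_simplicial:
  assumes ext: "extremal E X" and v: "X $ v $ v \<noteq> 0"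
    and nb: "\<And>u w. u \<noteq> w \<Longrightarrow> u \<noteq> v \<Longrightarrow> w \<noteq> v \<Longrightarrow> X $ u $ v \<noteq> 0 \<Longrightarrow> X $ w $ v \<noteq> 0 \<Longrightarrow> {u, w} \<in> E"
  obtains k where "X = k *\<^sub>R outer (column v X)" "0 < k"
proof -
  note X = extremal_cone[OF ext]
  let ?Y = "(1 / X $ v $ v) *\<^sub>R outer (column v X)"
  have pos: "0 < X $ v $ v" using v psd_diag_nonneg[OF X, of v] by simp
  have "?Y \<in> psd_cone UNIV" using pos outer_psd by (intro psd_cone_scaleR) auto
  moreover have pat: "?Y $ i $ j = 0" if "i \<noteq> j" "{i, j} \<notin> E" for i j
    using that nb[of i j] psd_cone_offpattern[OF X that] psd_cone_sym[OF X, of i j]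
    by (auto simp: column_nth)
  ultimately have Y: "?Y \<in> psd_cone E" unfolding psd_cone_iff[of _ E] by blast
  have "X - ?Y \<in> psd_cone E"
    unfolding psd_cone_iff[of _ E]
    using psd_Schur_complement[OF X v] pat psd_cone_offpattern[OF X] by simp
  moreover have "?Y \<noteq> 0"
  proof
    assume "?Y = 0"
    then have "?Y $ v $ v = (0 :: real^'a^'a) $ v $ v" by (rule arg_cong)
    then show False using v by (simp add: column_nth)
  qed
  ultimately obtain k where "X = k *\<^sub>R ?Y" "0 < k" using extremalD[OF ext Y] by blast
  then show ?thesis using that[of "k / X $ v $ v"] pos by simp
qed

section \<open>Rank under scaling and rank one updates\<close>

lemma rank_outer_add_le:
  fixes Z :: "real^'n^'n"
  shows "rank (c *\<^sub>R outer y + Z) \<le> 1 + rank Z"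
proof -
  have "range ((*v) (c *\<^sub>R outer y + Z)) \<subseteq> span (insert y (range ((*v) Z)))"
  proof clarify
    fix x
    have "(c *\<^sub>R outer y + Z) *v x = (c * (y \<bullet> x)) *\<^sub>R y + Z *v x"
      by (simp add: matrix_vector_mult_add_rdistrib scaleR_matrix_vector_assoc[symmetric] outer_mult)
    then show "(c *\<^sub>R outer y + Z) *v x \<in> span (insert y (range ((*v) Z)))"
      by (simp add: span_add span_scale span_base)
  qed
  then have "rank (c *\<^sub>R outer y + Z) \<le> dim (insert y (range ((*v) Z)))"
    unfolding rank_dim_range by (metis dim_span dim_subset)
  also have "\<dots> \<le> 1 + rank Z" unfolding rank_dim_range dim_insert by simp
  finally show ?thesis .
qed

lemma rank_scaleR:
  fixes X :: "real^'n^'n"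
  assumes "c \<noteq> 0" shows "rank (c *\<^sub>R X) = rank X"
proof -
  have "range ((*v) (c *\<^sub>R X)) = (\<lambda>x. c *\<^sub>R x) ` range ((*v) X)"
    by (auto simp: scaleR_matrix_vector_assoc[symmetric])
  also have "dim \<dots> = dim (range ((*v) X))"
    using assms by (intro dim_image_eq) (auto intro!: inj_onI linear_scaleR)
  finally show ?thesis by (simp add: rank_dim_range)
qed

lemma rank_outer:
  fixes X :: "real^'n^'n"
  assumes "X = k *\<^sub>R outer y" "X \<noteq> 0"
  shows "rank X = 1"
proof -
  have "rank X \<le> 1 + rank (0 :: real^'n^'n)" using rank_outer_add_le[of k y 0] assms by simp
  moreover have "rank X \<noteq> 0" using assms(2) by (simp add: rank_eq_0)
  ultimately show ?thesis by (simp add: rank_0)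
qed

lemma outer_column_support:
  assumes "X = k *\<^sub>R outer (column v X)" "X $ i $ i \<noteq> 0"
  shows "X $ i $ v \<noteq> 0"
  using assms by (metis column_nth mult_zero_left outer_nth scaleR_zero_right vector_scaleR_component)


section \<open>Extremal matrices and extremal rays\<close>

lemma extremal_summand:
  assumes ext: "extremal E X" and ab: "a \<in> psd_cone E" "b \<in> psd_cone E" "a + b = t *\<^sub>R X" "0 \<le> t"
  shows "\<exists>s\<ge>0. a = s *\<^sub>R X"
proof (cases "a = 0")
  case True
  then show ?thesis by (intro exI[of _ 0]) simp
next
  case False
  obtain i where "0 < a $ i $ i" using psd_nonzero_diag[OF ab(1) False] .
  moreover have "0 \<le> b $ i $ i" using psd_diag_nonneg[OF ab(2)] .
  moreover have "a $ i $ i + b $ i $ i = t * X $ i $ i"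
    using arg_cong[OF ab(3), of "\<lambda>A. A $ i $ i"] by simp
  ultimately have t: "0 < t" using ab(4) by (cases "t = 0") auto
  have "X = (1 / t) *\<^sub>R (t *\<^sub>R X)" using t by simp
  then have "X - (1 / t) *\<^sub>R a = (1 / t) *\<^sub>R b"
    unfolding ab(3)[symmetric] by (simp add: scaleR_add_right)
  then have "(1 / t) *\<^sub>R a \<in> psd_cone E" "X - (1 / t) *\<^sub>R a \<in> psd_cone E"
    using ab t by (simp_all add: psd_cone_scaleR)
  then obtain k where k: "X = k *\<^sub>R ((1 / t) *\<^sub>R a)" "0 < k"
    using extremalD[OF ext] False t by (metis divide_eq_0_iff scaleR_eq_0_iff zero_neq_one less_irrefl)
  then have "a = (t / k) *\<^sub>R X" using t by simp
  then show ?thesis using t k(2) by (intro exI[of _ "t / k"]) simp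
qed

lemma extremal_scaleR:
  assumes "extremal E X" "0 < c"
  shows "extremal E (c *\<^sub>R X)"
  unfolding extremal_def
proof (intro conjI ballI impI)
  fix A assume "A \<in> psd_cone E" "c *\<^sub>R X - A \<in> psd_cone E"
  then obtain s where "A = s *\<^sub>R X"
    using extremal_summand[OF assms(1), of A "c *\<^sub>R X - A" c] assms(2) by auto
  then show "\<exists>k. A = k *\<^sub>R c *\<^sub>R X" using assms(2) by (intro exI[of _ "s / c"]) simp
qed (use assms in \<open>auto simp: extremal_def psd_cone_scaleR\<close>)

lemma extremal_ray_of_extremal:
  assumes ext: "extremal E X"
  shows "extremal_ray (psd_cone E) {t *\<^sub>R X | t. 0 \<le> t}" (is "extremal_ray _ ?R")
proof -
  have "?R face_of psd_cone E"
    unfolding face_of_def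
  proof (intro conjI ballI impI)
    show "?R \<subseteq> psd_cone E" using extremal_cone[OF ext] by (auto intro: psd_cone_scaleR)
    show "convex ?R"
    proof (rule convexI)
      fix x y and u v :: real
      assume "x \<in> ?R" "y \<in> ?R" and uv: "0 \<le> u" "0 \<le> v" "u + v = 1"
      then obtain s t where "x = s *\<^sub>R X" "y = t *\<^sub>R X" "0 \<le> s" "0 \<le> t" by auto
      then have "u *\<^sub>R x + v *\<^sub>R y = (u * s + v * t) *\<^sub>R X" "0 \<le> u * s + v * t"
        using uv by (auto simp: scaleR_add_left)
      then show "u *\<^sub>R x + v *\<^sub>R y \<in> ?R" by blast
    qed
  next
    fix a b x
    assume ab: "a \<in> psd_cone E" "b \<in> psd_cone E" and "x \<in> ?R" "x \<in> open_segment a b"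
    then obtain u t where "0 < u" "u < 1" "x = (1 - u) *\<^sub>R a + u *\<^sub>R b" "x = t *\<^sub>R X" "0 \<le> t"
      by (auto simp: in_segment)
    then have u: "0 < u" "u < 1" "(1 - u) *\<^sub>R a + u *\<^sub>R b = t *\<^sub>R X" "0 \<le> t" by simp_all
    have mem: "(1 - u) *\<^sub>R a \<in> psd_cone E" "u *\<^sub>R b \<in> psd_cone E"
      using ab u by (simp_all add: psd_cone_scaleR)
    obtain s where s: "0 \<le> s" "(1 - u) *\<^sub>R a = s *\<^sub>R X"
      using extremal_summand[OF ext mem u(3,4)] by auto
    obtain r where r: "0 \<le> r" "u *\<^sub>R b = r *\<^sub>R X"
      using extremal_summand[OF ext mem(2,1) _ u(4)] u(3) by (auto simp: add.commute)
    have "a = (s / (1 - u)) *\<^sub>R X" "b = (r / u) *\<^sub>R X"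
      using arg_cong[OF s(2), of "\<lambda>A. (1 / (1 - u)) *\<^sub>R A"]
        arg_cong[OF r(2), of "\<lambda>A. (1 / u) *\<^sub>R A"] u by simp_all
    moreover have "0 \<le> s / (1 - u)" "0 \<le> r / u" using s r u by simp_all
    ultimately show "a \<in> ?R" "b \<in> ?R" by blast+
  qed
  then show ?thesis using extremal_nonzero[OF ext] by (auto simp: extremal_ray_def)
qed

text \<open>The midpoint of \<open>A\<close> and \<open>X - A\<close> is half of \<open>X\<close>, a
  point of the ray, so the face property puts \<open>A\<close> on the ray as well.\<close>

lemma extremal_of_extremal_ray:
  assumes R: "extremal_ray (psd_cone E) R" and X: "X \<in> R" "X \<noteq> 0"
  shows "extremal E X"
proof -
  obtain x where x: "R = {t *\<^sub>R x | t. 0 \<le> t}" and face: "R face_of psd_cone E"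
    using R by (auto simp: extremal_ray_def)
  obtain t where t: "X = t *\<^sub>R x" "t \<noteq> 0" "0 \<le> t" using X x by auto
  have "\<exists>k. A = k *\<^sub>R X" if A: "A \<in> psd_cone E" "X - A \<in> psd_cone E" for A
  \<comment> \<open>The open segment is empty when its end points coincide, so \<open>A\<close>
    equal to half of \<open>X\<close> is treated apart.\<close>
  proof (cases "A = X - A")
    case True
    then have "A + A = X" by (metis add_diff_cancel_left' diff_add_cancel)
    then have "A = (1 / 2) *\<^sub>R X" by (metis scaleR_half_double)
    then show ?thesis by blast
  next
    case False
    have "(1 / 2) *\<^sub>R X = (1 - 1 / 2) *\<^sub>R A + (1 / 2) *\<^sub>R (X - A)"
      by (simp add: scaleR_diff_right)
    then have "(1 / 2) *\<^sub>R X \<in> open_segment A (X - A)"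
      using False unfolding in_segment by (intro conjI exI[of _ "1 / 2"]) simp_all
    moreover have "(1 / 2) *\<^sub>R X = (t / 2) *\<^sub>R x" "0 \<le> t / 2" using t by simp_all
    then have "(1 / 2) *\<^sub>R X \<in> R" unfolding x by blast
    ultimately have "A \<in> R" using face A unfolding face_of_def by blast
    then obtain s where "A = s *\<^sub>R x" using x by auto
    then have "A = (s / t) *\<^sub>R X" using t by simp
    then show ?thesis by blast
  qed
  then show ?thesis using X face_of_imp_subset[OF face] by (auto simp: extremal_def)
qed

lemma extremal_ranks_eq: "extremal_ranks E = {rank X | X. extremal E X}"
proof (intro equalityI subsetI)
  fix r assume "r \<in> extremal_ranks E"
  then obtain X R where "r = rank X" "extremal_ray (psd_cone E) R" "X \<in> R" "X \<noteq> 0"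
    by (auto simp: extremal_ranks_def)
  then show "r \<in> {rank X | X. extremal E X}" using extremal_of_extremal_ray by blast
next
  fix r assume "r \<in> {rank X | X. extremal E X}"
  then obtain X where X: "r = rank X" "extremal E X" by auto
  have "X = 1 *\<^sub>R X" by simp
  then have "X \<in> {t *\<^sub>R X | t. 0 \<le> t}" using zero_le_one by blast
  then show "r \<in> extremal_ranks E"
    unfolding extremal_ranks_def mem_Collect_eq
    using X extremal_ray_of_extremal[OF X(2)] extremal_nonzero[OF X(2)] by blast
qed

section \<open>The compact base of the cone and extremal summands\<close>

lemma psd_trace_pos:
  assumes "X \<in> psd_cone E" "X \<noteq> 0"
  shows "0 < trace X"
proof -
  obtain i where "0 < X $ i $ i" using psd_nonzero_diag[OF assms] .
  then show ?thesis unfolding trace_def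
    using psd_diag_nonneg[OF assms(1)] by (intro sum_pos2[of _ i]) auto
qed

lemma trace_scaleR: "trace (c *\<^sub>R X) = c * trace (X :: real^'n^'n)"
  by (simp add: trace_def sum_distrib_left)

lemma closed_psd_cone: "closed (psd_cone E)"
proof -
  have "psd_cone E = {X. (\<forall>i j. X $ i $ j = X $ j $ i)} \<inter> {X. \<forall>x. 0 \<le> x \<bullet> (X *v x)} \<inter>
      (\<Inter>i. \<Inter>j. if i \<noteq> j \<and> {i, j} \<notin> E then {X. X $ i $ j = 0} else UNIV)"
    by (auto simp: psd_cone_def transpose_def vec_eq_iff split: if_splits)
  moreover have "closed {X :: real^'a^'a. \<forall>x. 0 \<le> x \<bullet> (X *v x)}"
    unfolding inner_vec_def matrix_vector_mult_def
    by (intro closed_Collect_all closed_Collect_le continuous_intros)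
  ultimately show ?thesis
    by (auto intro!: closed_Int closed_Collect_all closed_Collect_eq closed_INT continuous_intros)
qed

text \<open>Trace one bounds the nonnegative diagonal entries by one, and the two by two minors then
  bound all other entries.\<close>

lemma compact_trace_slice: "compact {X \<in> psd_cone E. trace X = 1}"
proof -
  have "norm X \<le> (\<Sum>i\<in>(UNIV :: 'a set). \<Sum>j\<in>(UNIV :: 'a set). 1)"
    if X: "X \<in> psd_cone E" "trace X = 1" for X
  proof -
    have diag: "X $ i $ i \<le> 1" for i
      using member_le_sum[of i UNIV "\<lambda>i. X $ i $ i"] psd_diag_nonneg[OF X(1)] X(2)
      by (simp add: trace_def)
    have entry: "\<bar>X $ i $ j\<bar> \<le> 1" for i j
    proof -
      have "(X $ i $ j)\<^sup>2 \<le> 1 * 1"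
        using psd_entry_sq[OF X(1), of i j] mult_mono[OF diag[of i] diag[of j]] psd_diag_nonneg[OF X(1)]
        by auto
      then show ?thesis by (simp add: abs_square_le_1)
    qed
    have "norm X \<le> (\<Sum>i\<in>UNIV. norm (X $ i))" unfolding norm_vec_def by (intro L2_set_le_sum) auto
    also have "\<dots> \<le> (\<Sum>i\<in>UNIV. \<Sum>j\<in>UNIV. \<bar>X $ i $ j\<bar>)" by (intro sum_mono norm_le_l1_cart)
    also have "\<dots> \<le> (\<Sum>i\<in>(UNIV :: 'a set). \<Sum>j\<in>(UNIV :: 'a set). 1)" by (intro sum_mono entry)
    finally show ?thesis .
  qed
  then have "bounded {X \<in> psd_cone E. trace X = 1}" unfolding bounded_iff by blast
  moreover have "closed {X \<in> psd_cone E. trace X = 1}"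
    unfolding trace_def
    by (intro closed_Collect_conj closed_Collect_eq continuous_intros)
      (simp add: closed_psd_cone)
  ultimately show ?thesis by (simp add: compact_eq_bounded_closed)
qed

lemma convex_trace_slice: "convex {X \<in> psd_cone E. trace X = 1}"
  by (rule convexI) (auto simp: psd_cone_add psd_cone_scaleR trace_add trace_scaleR)

text \<open>A splitting of \<open>p\<close> into \<open>A\<close> and \<open>p - A\<close> becomes a
  convex combination within the slice once both parts are divided by their traces s and 1 -
  s.\<close>

lemma extremal_of_extreme_point:
  assumes p: "p extreme_point_of {X \<in> psd_cone E. trace X = 1}"
  shows "extremal E p"
proof -
  have p': "p \<in> psd_cone E" "trace p = 1" using p by (auto simp: extreme_point_of_def)
  have "p \<noteq> 0" using p'(2) by (auto simp: trace_def)
  moreover have "\<exists>k. A = k *\<^sub>R p" if A: "A \<in> psd_cone E" "p - A \<in> psd_cone E" for A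
  proof (cases "A = 0 \<or> p - A = 0")
    case True
    then have "A = 0 *\<^sub>R p \<or> A = 1 *\<^sub>R p" by auto
    then show ?thesis by blast
  next
    case False
    define s where "s = trace A"
    have s: "0 < s" "s < 1" using psd_trace_pos[OF A(1)] psd_trace_pos[OF A(2)] False p'(2)
      by (auto simp: s_def trace_sub)
    let ?a = "(1 / s) *\<^sub>R A" and ?b = "(1 / (1 - s)) *\<^sub>R (p - A)"
    have "?a \<in> {X \<in> psd_cone E. trace X = 1}" "?b \<in> {X \<in> psd_cone E. trace X = 1}"
      using A s p'(2) by (auto intro!: psd_cone_scaleR simp: trace_scaleR trace_sub s_def)
    then have "p \<notin> open_segment ?b ?a" using p by (auto simp: extreme_point_of_def)
    moreover have eq: "p = (1 - s) *\<^sub>R ?b + s *\<^sub>R ?a" using s by simp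
    ultimately have "?b = ?a" using s unfolding in_segment by blast
    then have "p = ?a" using eq by (metis add.commute add_diff_cancel_left' diff_add_cancel scaleR_left.add scaleR_one)
    then have "A = s *\<^sub>R p" using s by (metis divide_self_if less_irrefl scaleR_one scaleR_scaleR times_divide_eq_right mult.right_neutral)
    then show ?thesis by blast
  qed
  ultimately show ?thesis using p' by (auto simp: extremal_def)
qed

text \<open>By Minkowski's theorem for the trace slice, \<open>X\<close> is a finite sum of
  nonnegative multiples of extremal matrices. As \<open>l\<close> is positive on the sum, it is
  positive on some term, and the remaining terms keep the difference in the cone.\<close>

lemma extremal_summand_exists:
  assumes X: "X \<in> psd_cone E" and l: "linear l" "(0::real) < l X"
  obtains Z where "extremal E Z" "X - Z \<in> psd_cone E" "0 < l Z"
proof -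
  let ?B = "{X \<in> psd_cone E. trace X = 1}"
  have "X \<noteq> 0" using l linear_0 by force
  then have t: "0 < trace X" using psd_trace_pos[OF X] by simp
  have "(1 / trace X) *\<^sub>R X \<in> ?B" using X t by (simp add: psd_cone_scaleR trace_scaleR)
  then have "(1 / trace X) *\<^sub>R X \<in> convex hull {p. p extreme_point_of ?B}"
    by (rule set_mp[OF equalityD1[OF Krein_Milman_Minkowski[OF compact_trace_slice
            convex_trace_slice]]])
  then obtain S c where S: "finite S" "\<And>p. p \<in> S \<Longrightarrow> p extreme_point_of ?B"
      "\<And>p. p \<in> S \<Longrightarrow> 0 \<le> c p" "(\<Sum>p\<in>S. c p *\<^sub>R p) = (1 / trace X) *\<^sub>R X"
    unfolding convex_hull_explicit by blast
  have "(\<Sum>p\<in>S. trace X *\<^sub>R (c p *\<^sub>R p)) = trace X *\<^sub>R (\<Sum>p\<in>S. c p *\<^sub>R p)"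
    by (simp only: scaleR_sum_right)
  also have "\<dots> = X" using t unfolding S(4) by simp
  finally have sum: "(\<Sum>p\<in>S. trace X *\<^sub>R (c p *\<^sub>R p)) = X" .
  have ext: "extremal E p" if "p \<in> S" for p using extremal_of_extreme_point[OF S(2)[OF that]] .
  have mem: "trace X *\<^sub>R (c p *\<^sub>R p) \<in> psd_cone E" if "p \<in> S" for p
    using t S(3)[OF that] extremal_cone[OF ext[OF that]] by (auto intro!: psd_cone_scaleR)
  have "0 < (\<Sum>p\<in>S. l (trace X *\<^sub>R (c p *\<^sub>R p)))" unfolding linear_sum[OF l(1), symmetric] sum by (rule l(2))
  then have "\<not> (\<forall>p\<in>S. l (trace X *\<^sub>R (c p *\<^sub>R p)) \<le> 0)"
    using sum_nonpos[of S "\<lambda>p. l (trace X *\<^sub>R (c p *\<^sub>R p))"] by fastforce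
  then obtain p where p: "p \<in> S" "0 < l (trace X *\<^sub>R (c p *\<^sub>R p))" by (auto simp: not_le)
  have partial: "(\<Sum>p\<in>T. trace X *\<^sub>R (c p *\<^sub>R p)) \<in> psd_cone E" if "T \<subseteq> S" for T
    using finite_subset[OF that S(1)] that
    by (induction T rule: finite_induct)
      (auto intro!: psd_cone_add psd_cone_zero mem simp del: scaleR_scaleR)
  have "X - trace X *\<^sub>R (c p *\<^sub>R p) = (\<Sum>p\<in>S - {p}. trace X *\<^sub>R (c p *\<^sub>R p))"
    using sum S(1) p(1) by (simp add: sum_diff1)
  then have diff: "X - trace X *\<^sub>R (c p *\<^sub>R p) \<in> psd_cone E" using partial[of "S - {p}"] by auto
  have "c p \<noteq> 0" using p(2) linear_0[OF l(1)] by auto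
  then have "0 < c p" using S(3)[OF p(1)] by simp
  then have "extremal E (trace X *\<^sub>R (c p *\<^sub>R p))"
    using ext[OF p(1)] t by (simp add: extremal_scaleR)
  then show ?thesis using that diff p(2) by blast
qed


section \<open>Chordless cycles\<close>

definition path_edges :: "'a list \<Rightarrow> 'a set set" where
  "path_edges vs = {{vs ! i, vs ! Suc i} | i. Suc i < length vs}"

lemma cycle_edges_conv_path_edges:
  assumes "vs \<noteq> []"
  shows "cycle_edges vs = insert {last vs, hd vs} (path_edges vs)"
proof (intro equalityI subsetI)
  fix e assume "e \<in> cycle_edges vs"
  then obtain i where i: "i < length vs" "e = {vs ! i, vs ! (Suc i mod length vs)}"
    by (auto simp: cycle_edges_def)
  show "e \<in> insert {last vs, hd vs} (path_edges vs)"
  proof (cases "Suc i < length vs")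
    case True
    then show ?thesis using i by (auto simp: path_edges_def)
  next
    case False
    then have "Suc i = length vs" using i by simp
    then show ?thesis using i assms by (simp add: last_conv_nth hd_conv_nth flip: \<open>Suc i = length vs\<close>)
  qed
next
  fix e assume "e \<in> insert {last vs, hd vs} (path_edges vs)"
  then consider "e = {last vs, hd vs}" | i where "Suc i < length vs" "e = {vs ! i, vs ! Suc i}"
    by (auto simp: path_edges_def)
  then show "e \<in> cycle_edges vs"
  proof cases
    case 1
    then have "e = {vs ! (length vs - 1), vs ! (Suc (length vs - 1) mod length vs)}"
      using assms by (simp add: last_conv_nth hd_conv_nth)
    moreover have "length vs - 1 < length vs" using assms by simp
    ultimately show ?thesis unfolding cycle_edges_def by blast
  next
    case 2
    then have "e = {vs ! i, vs ! (Suc i mod length vs)}" "i < length vs" by auto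
    then show ?thesis unfolding cycle_edges_def by blast
  qed
qed

lemma path_edges_snoc:
  assumes "vs \<noteq> []"
  shows "path_edges (vs @ [v]) = insert {last vs, v} (path_edges vs)"
proof (intro equalityI subsetI)
  fix e assume "e \<in> path_edges (vs @ [v])"
  then obtain i where i: "i < length vs" "e = {vs ! i, (vs @ [v]) ! Suc i}"
    by (auto simp: path_edges_def nth_append)
  show "e \<in> insert {last vs, v} (path_edges vs)"
  proof (cases "Suc i < length vs")
    case True
    then show ?thesis using i by (auto simp: path_edges_def nth_append)
  next
    case False
    then have "i = length vs - 1" using i by simp
    then show ?thesis using i assms by (simp add: last_conv_nth nth_append)
  qed
next
  fix e assume "e \<in> insert {last vs, v} (path_edges vs)"
  then consider "e = {last vs, v}" | i where "Suc i < length vs" "e = {vs ! i, vs ! Suc i}"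
    by (auto simp: path_edges_def)
  then show "e \<in> path_edges (vs @ [v])"
  proof cases
    case 1
    then have "e = {(vs @ [v]) ! (length vs - 1), (vs @ [v]) ! Suc (length vs - 1)}"
      using assms by (simp add: last_conv_nth nth_append)
    moreover have "Suc (length vs - 1) < length (vs @ [v])" using assms by simp
    ultimately show ?thesis unfolding path_edges_def by blast
  next
    case 2
    then have "e = {(vs @ [v]) ! i, (vs @ [v]) ! Suc i}" "Suc i < length (vs @ [v])"
      by (simp_all add: nth_append)
    then show ?thesis unfolding path_edges_def by blast
  qed
qed

text \<open>Three vertices are essential: on two, the closing edge is the single path edge.\<close>

lemma closing_edge_notin_path_edges:
  assumes "distinct vs" "3 \<le> length vs"
  shows "{last vs, hd vs} \<notin> path_edges vs"
proof
  assume "{last vs, hd vs} \<in> path_edges vs"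
  then obtain i where i: "Suc i < length vs" "{last vs, hd vs} = {vs ! i, vs ! Suc i}"
    by (auto simp: path_edges_def)
  have "vs \<noteq> []" using assms(2) by auto
  then have "{vs ! (length vs - 1), vs ! 0} = {vs ! i, vs ! Suc i}"
    using i by (simp add: last_conv_nth hd_conv_nth)
  then have "length vs - 1 = i \<and> 0 = Suc i \<or> length vs - 1 = Suc i \<and> 0 = i"
    using assms(2) i(1) \<open>vs \<noteq> []\<close> nth_eq_iff_index_eq[OF assms(1), of "length vs - 1" i]
      nth_eq_iff_index_eq[OF assms(1), of "length vs - 1" "Suc i"]
      nth_eq_iff_index_eq[OF assms(1), of 0 i] nth_eq_iff_index_eq[OF assms(1), of 0 "Suc i"]
    by (auto simp: doubleton_eq_iff)
  then show False using assms(2) by auto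
qed

lemma cycle_edges_rotate:
  assumes "k \<le> length vs"
  shows "cycle_edges (rotate k vs) = cycle_edges vs"
proof (intro equalityI subsetI)
  let ?n = "length vs"
  have edge: "{rotate k vs ! i, rotate k vs ! (Suc i mod ?n)} =
      {vs ! ((k + i) mod ?n), vs ! (Suc ((k + i) mod ?n) mod ?n)}" if "i < ?n" for i
  proof -
    have "Suc i mod ?n < ?n" using that by (intro mod_less_divisor) linarith
    then show ?thesis using that by (simp add: nth_rotate mod_simps)
  qed
  fix e
  {
    assume "e \<in> cycle_edges (rotate k vs)"
    then obtain i where i: "i < ?n" "e = {rotate k vs ! i, rotate k vs ! (Suc i mod ?n)}"
      by (auto simp: cycle_edges_def)
    then have "0 < ?n" by linarith
    then have "(k + i) mod ?n < ?n" by (rule mod_less_divisor)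
    then show "e \<in> cycle_edges vs" unfolding cycle_edges_def i(2) edge[OF i(1)] by blast
  next
    assume "e \<in> cycle_edges vs"
    then obtain j where j: "j < ?n" "e = {vs ! j, vs ! (Suc j mod ?n)}"
      by (auto simp: cycle_edges_def)
    define i where "i = (j + (?n - k)) mod ?n"
    have i: "i < ?n" unfolding i_def using j(1) by (intro mod_less_divisor) linarith
    have "(k + i) mod ?n = (k + (j + (?n - k))) mod ?n" unfolding i_def by (simp add: mod_simps)
    also have "k + (j + (?n - k)) = j + ?n" using assms by simp
    finally have "(k + i) mod ?n = j" using j by simp
    then have "e = {rotate k vs ! i, rotate k vs ! (Suc i mod length (rotate k vs))}"
      using edge[OF i] j(2) by simp
    moreover have "i < length (rotate k vs)" using i by simp
    ultimately show "e \<in> cycle_edges (rotate k vs)" unfolding cycle_edges_def by blast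
  }
qed

lemma chordless_cycle_rotate:
  "chordless_cycle E vs \<Longrightarrow> k \<le> length vs \<Longrightarrow> chordless_cycle E (rotate k vs)"
  by (simp add: chordless_cycle_def cycle_edges_rotate)

text \<open>Rotates the list until a given edge joins its last and first entries, so that this edge
  can be subdivided by appending a vertex.\<close>

lemma chordless_cycle_closing_edge:
  assumes C: "chordless_cycle E vs" and e: "e \<in> E" "e \<subseteq> set vs"
  obtains us where "chordless_cycle E us" "set us = set vs" "length us = length vs" "{last us, hd us} = e"
proof -
  have "e \<in> cycle_edges vs" using C e by (auto simp: chordless_cycle_def)
  then obtain i where i: "i < length vs" "e = {vs ! i, vs ! (Suc i mod length vs)}"
    by (auto simp: cycle_edges_def)
  let ?us = "rotate (Suc i) vs"
  have ne: "?us \<noteq> []" "0 < length vs" using i by auto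
  have "last ?us = vs ! i"
    using ne i by (simp add: last_conv_nth nth_rotate del: rotate_Suc)
  moreover have "hd ?us = vs ! (Suc i mod length vs)"
    using ne i by (simp add: hd_conv_nth nth_rotate del: rotate_Suc)
  ultimately have "{last ?us, hd ?us} = e" using i by simp
  moreover have "chordless_cycle E ?us" using C i by (intro chordless_cycle_rotate) auto
  ultimately show ?thesis using that[of ?us] by simp
qed

lemma chordless_cycle_vertex_edge:
  assumes "chordless_cycle E vs" "v \<in> set vs"
  obtains e where "e \<in> E" "v \<in> e"
proof -
  obtain i where i: "i < length vs" "vs ! i = v" using assms(2) by (auto simp: in_set_conv_nth)
  then have "{vs ! i, vs ! (Suc i mod length vs)} \<in> E"
    using assms(1) by (auto simp: chordless_cycle_def cycle_edges_def)
  then show ?thesis using that i by blast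
qed

lemma chordless_cycle_delete:
  assumes C: "chordless_cycle {e \<in> E. v \<notin> e} vs"
  shows "chordless_cycle E vs"
proof -
  have "v \<notin> set vs" using chordless_cycle_vertex_edge[OF C, of v] by blast
  then have "{e \<in> {e \<in> E. v \<notin> e}. e \<subseteq> set vs} = {e \<in> E. e \<subseteq> set vs}" by auto
  then show ?thesis using C by (auto simp: chordless_cycle_def)
qed

text \<open>Undoes the elimination of \<open>v\<close>: the fill-in edge is replaced by the path
  over \<open>v\<close>. No chord arises, because \<open>v\<close> has no other neighbours and
  \<open>uw\<close> is not an edge of \<open>E\<close>.\<close>

lemma chordless_cycle_subdivide:
  assumes G: "simple_graph (V, E)" and N: "nbrs E v = {u, w}" and uw: "{u, w} \<notin> E" "v \<noteq> u" "v \<noteq> w"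
    and C: "chordless_cycle (insert {u, w} {e \<in> E. v \<notin> e}) vs" and cl: "{last vs, hd vs} = {u, w}"
  shows "chordless_cycle E (vs @ [v])" "v \<notin> set vs"
proof -
  let ?E = "insert {u, w} {e \<in> E. v \<notin> e}"
  show v: "v \<notin> set vs" using chordless_cycle_vertex_edge[OF C, of v] uw by blast
  have len: "3 \<le> length vs" and dist: "distinct vs"
    and ind: "{e \<in> ?E. e \<subseteq> set vs} = cycle_edges vs"
    using C by (auto simp: chordless_cycle_def)
  have ne: "vs \<noteq> []" using len by auto
  have ce: "cycle_edges (vs @ [v]) = {{v, hd vs}, {last vs, v}} \<union> path_edges vs"
    using ne by (simp add: cycle_edges_conv_path_edges path_edges_snoc)
  have cev: "cycle_edges vs = insert {u, w} (path_edges vs)"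
    using cycle_edges_conv_path_edges[OF ne] cl by simp
  have notin: "{u, w} \<notin> path_edges vs" using closing_edge_notin_path_edges[OF dist len] cl by simp
  have path: "path_edges vs = {e \<in> E. e \<subseteq> set vs}"
  proof -
    have "path_edges vs = cycle_edges vs - {{u, w}}" using cev notin by auto
    also have "\<dots> = {e \<in> E. e \<subseteq> set vs}" unfolding ind[symmetric] using uw v by auto
    finally show ?thesis .
  qed
  have ends: "{v, x} \<in> E \<longleftrightarrow> x = last vs \<or> x = hd vs" for x
  proof -
    have "{v, x} \<in> E \<longleftrightarrow> x \<in> {last vs, hd vs}" unfolding cl N[symmetric] by (simp add: nbrs_def)
    then show ?thesis by simp
  qed
  have star: "{e \<in> E. e \<subseteq> set (vs @ [v])} = cycle_edges (vs @ [v])"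
  proof (intro equalityI subsetI)
    fix e assume e: "e \<in> {e \<in> E. e \<subseteq> set (vs @ [v])}"
    show "e \<in> cycle_edges (vs @ [v])"
    proof (cases "v \<in> e")
      case True
      obtain a b where "e = {a, b}" using simple_graphE[OF G, of e] e by blast
      then obtain x where "e = {v, x}" using True by (auto simp: insert_commute)
      then show ?thesis using ends[of x] e unfolding ce by (auto simp: insert_commute)
    next
      case False
      then show ?thesis using e unfolding ce path by auto
    qed
  next
    fix e assume "e \<in> cycle_edges (vs @ [v])"
    moreover have "{v, hd vs} \<in> E" "{last vs, v} \<in> E"
      using ends[of "hd vs"] ends[of "last vs"] insert_commute[of v "last vs" "{}"] by simp_all
    ultimately show "e \<in> {e \<in> E. e \<subseteq> set (vs @ [v])}"
      using ne unfolding ce path by auto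
  qed
  then have "cycle_edges (vs @ [v]) \<subseteq> E" by auto
  then show "chordless_cycle E (vs @ [v])"
    using star dist v len by (simp add: chordless_cycle_def)
qed

lemma chordless_triangle:
  assumes G: "simple_graph (V, E)" and E: "{a, b} \<in> E" "{b, c} \<in> E" "{a, c} \<in> E"
  shows "chordless_cycle E [a, b, c]"
proof -
  have neq: "a \<noteq> b" "b \<noteq> c" "a \<noteq> c" using E simple_graph_pair_neq[OF G] by blast+
  have ce: "cycle_edges [a, b, c] = {{c, a}, {a, b}, {b, c}}"
    using cycle_edges_conv_path_edges[of "[a, b, c]"] path_edges_snoc[of "[a, b]" c]
      path_edges_snoc[of "[a]" b]
    by (simp add: path_edges_def)  auto
  have "e \<in> {{c, a}, {a, b}, {b, c}}" if e: "e \<in> E" "e \<subseteq> {a, b, c}" for e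
  proof -
    obtain x y where "e = {x, y}" "x \<noteq> y" using G e(1) by (rule simple_graphE)
    then show ?thesis using e(2) by (auto simp: insert_commute)
  qed
  then show ?thesis using E neq unfolding chordless_cycle_def ce by (auto simp: insert_commute)
qed

section \<open>Supports of extremal matrices\<close>

text \<open>Identifies the fill-in pattern left by eliminating \<open>v\<close> with a contraction,
  so elimination stays within series-parallel graphs.\<close>

lemma contract_degree_two:
  assumes G: "simple_graph (V, E)" and N: "nbrs E v = {u, w}" and uw: "u \<noteq> w"
  shows "contract E u v = insert {u, w} {e \<in> E. v \<notin> e}" (is "?L = ?R")
proof -
  have E: "{v, x} \<in> E \<longleftrightarrow> x = u \<or> x = w" for x
  proof -
    have "{v, x} \<in> E \<longleftrightarrow> x \<in> {u, w}" unfolding N[symmetric] by (simp add: nbrs_def)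
    then show ?thesis by simp
  qed
  have "v \<notin> nbrs E v" using G by (rule nbrs_irrefl)
  then have neq: "u \<noteq> v" "w \<noteq> v" using N by auto
  have "u \<in> V" using nbrs_subset[OF G, of v] N by auto
  then have L: "simple_graph (V - {v}, ?L)" using G neq by (intro simple_graph_contract) auto
  have "{x, y} \<in> ?L \<longleftrightarrow> {x, y} \<in> ?R" for x y
    unfolding contract_iff[OF G neq(1)] using E neq uw by (auto simp: doubleton_eq_iff)
  moreover have "\<exists>x y. e = {x, y}" if "e \<in> ?L" for e
    using simple_graphE[OF L that] by metis
  moreover have "\<exists>x y. e = {x, y}" if "e \<in> ?R" for e
    using that simple_graphE[OF G, of e] by (metis (no_types, lifting) insert_iff mem_Collect_eq)
  ultimately show ?thesis by (metis (no_types, lifting) subsetI subset_antisym)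
qed

lemma extremal_delete_vertex:
  assumes ext: "extremal E X" and v: "X $ v $ v = 0"
  shows "extremal {e \<in> E. v \<notin> e} X"
proof (rule extremal_subpattern[OF ext])
  note X = extremal_cone[OF ext]
  have "X $ i $ j = 0" if "i \<noteq> j" "{i, j} \<notin> {e \<in> E. v \<notin> e}" for i j
    using that psd_cone_offpattern[OF X that(1)] psd_diag_zero[OF X v] by auto
  then show "X \<in> psd_cone {e \<in> E. v \<notin> e}"
    unfolding psd_cone_iff[of X "{e \<in> E. v \<notin> e}"] using psd_cone_UNIV_D[OF X] by blast
qed auto

text \<open>
  Eliminating a vertex \<open>v\<close> of degree two with nonadjacent neighbours \<open>u\<close> and \<open>w\<close> creates the fill-in
  edge \<open>uw\<close>. Some extremal summand \<open>Z\<close> of the Schur complement has a fill-in entry opposite in sign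
  to that of the rank one term, so a combination of the two lies in the original cone.
\<close>

lemma extremal_eliminate_degree_two:
  assumes ext: "extremal E X" and N: "nbrs E v = {u, w}"
    and uw: "u \<noteq> w" "{u, w} \<notin> E" and nz: "X $ u $ v \<noteq> 0" "X $ w $ v \<noteq> 0"
  obtains Z k t where "extremal (insert {u, w} {e \<in> E. v \<notin> e}) Z" "Z $ u $ w \<noteq> 0"
    "\<And>i. Z $ i $ i \<noteq> 0 \<Longrightarrow> X $ i $ i \<noteq> 0" "Z $ v $ v = 0" "0 < k"
    "X = k *\<^sub>R (t *\<^sub>R outer (column v X) + Z)"
proof -
  note X = extremal_cone[OF ext]
  let ?E = "insert {u, w} {e \<in> E. v \<notin> e}"
  define Y where "Y = outer (column v X)"
  define c where "c = 1 / X $ v $ v"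
  have Yij: "Y $ i $ j = X $ i $ v * X $ j $ v" for i j by (simp add: Y_def column_nth)
  have "X $ v $ v \<noteq> 0" using psd_diag_zero[OF X] nz by blast
  then have pos: "0 < X $ v $ v" using psd_diag_nonneg[OF X, of v] by simp
  then have c: "0 < c" "c * X $ v $ v = 1" by (simp_all add: c_def)
  have Xv: "x = v \<or> x = u \<or> x = w" if "X $ x $ v \<noteq> 0" for x
  proof (rule ccontr)
    assume *: "\<not> ?thesis"
    then have "x \<notin> nbrs E v" using N by simp
    then have "{x, v} \<notin> E" by (simp add: nbrs_def insert_commute)
    then show False using psd_cone_offpattern[OF X, of x v] that * by simp
  qed
  have Y_psd: "Y \<in> psd_cone UNIV" unfolding Y_def by (rule outer_psd)
  have Y_off: "Y $ i $ j = 0" if "i \<noteq> j" "i \<noteq> v" "j \<noteq> v" "{i, j} \<noteq> {u, w}" for i j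
    using that Xv[of i] Xv[of j] by (auto simp: Yij)
  define X' where "X' = X - c *\<^sub>R Y"
  have X'v: "X' $ v $ j = 0" "X' $ j $ v = 0" for j
    using c(2) psd_cone_sym[OF X, of v j] by (simp_all add: X'_def Yij mult.assoc[symmetric])
  have X'_psd: "X' \<in> psd_cone UNIV"
    using psd_Schur_complement[OF X, of v] pos by (simp add: X'_def Y_def c_def)
  have "X' $ i $ j = 0" if "i \<noteq> j" "{i, j} \<notin> ?E" for i j
  proof (cases "i = v \<or> j = v")
    case False
    then have "{i, j} \<notin> E" "{i, j} \<noteq> {u, w}" using that by auto
    then show ?thesis
      using psd_cone_offpattern[OF X that(1)] Y_off[OF that(1)] False by (simp add: X'_def)
  qed (use X'v in auto)
  then have X': "X' \<in> psd_cone ?E" unfolding psd_cone_iff[of X' ?E] using X'_psd by blast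
  define s where "s = Y $ u $ w"
  have s: "s \<noteq> 0" using nz by (simp add: s_def Yij)
  have Xuw: "X $ u $ w = 0" using psd_cone_offpattern[OF X uw] .
  \<comment> \<open>The functional singles out a fill-in entry of sign opposite to \<open>s\<close>.
    It is positive on \<open>X'\<close>, since \<open>X\<close> has no entry at the non-edge
    \<open>uw\<close> and the whole entry of \<open>X'\<close> there is - c * s.\<close>
  have "linear (\<lambda>A :: real^'a^'a. - s * A $ u $ w)" by (rule linearI) (simp_all add: algebra_simps)
  moreover have "- s * X' $ u $ w = c * s\<^sup>2"
    using Xuw by (simp add: X'_def s_def[symmetric] power2_eq_square)
  then have "0 < - s * X' $ u $ w" using s c(1) by simp
  ultimately obtain Z where Z: "extremal ?E Z" "X' - Z \<in> psd_cone ?E" "0 < - s * Z $ u $ w"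
    by (rule extremal_summand_exists[OF X'])
  note Zc = extremal_cone[OF Z(1)]
  \<comment> \<open>The weight at which the fill-in entries of \<open>t *\<^sub>R Y\<close> and
    \<open>Z\<close> cancel, so that their sum \<open>W\<close> respects the original
    pattern.\<close>
  define t where "t = - Z $ u $ w / s"
  have t: "0 < t" "t * s = - Z $ u $ w"
    using Z(3) s
    by (auto simp: t_def zero_less_divide_iff divide_less_0_iff zero_less_mult_iff mult_less_0_iff)
  define W where "W = t *\<^sub>R Y + Z"
  \<comment> \<open>Shrinks \<open>W\<close> until it fits below \<open>X\<close>: the part along
    \<open>Y\<close> must stay below \<open>c\<close>, the part along \<open>Z\<close> below
    one.\<close>
  define d where "d = min 1 (c / t)"
  have d: "0 < d" "d \<le> 1" "d * t \<le> c"
    using c(1) t(1) by (auto simp: d_def min_def field_simps)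
  have Z_le: "0 \<le> Z $ i $ i" "Z $ i $ i \<le> X' $ i $ i" for i using psd_diag_le[OF Zc Z(2)] by auto
  have Zv: "Z $ v $ v = 0" using Z_le[of v] X'v by simp
  have W_off: "W $ i $ j = 0" if "i \<noteq> j" "{i, j} \<notin> E" for i j
  proof (cases "{i, j} = {u, w}")
    case True
    then have "W $ i $ j = W $ u $ w"
      by (auto simp: doubleton_eq_iff W_def Yij psd_cone_sym[OF Zc, of w u])
    then show ?thesis using t(2) by (simp add: W_def s_def)
  next
    case False
    have "Y $ i $ j = 0"
    proof (cases "i = v \<or> j = v")
      case True
      then show ?thesis using psd_cone_offpattern[OF X that] psd_cone_sym[OF X, of i j]
        by (auto simp: Yij)
    qed (use Y_off[OF that(1)] False in auto)
    moreover have "Z $ i $ j = 0" using psd_cone_offpattern[OF Zc that(1)] that(2) False by auto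
    ultimately show ?thesis by (simp add: W_def)
  qed
  have "W \<in> psd_cone UNIV" unfolding W_def
    using t Y_psd psd_cone_UNIV_D[OF Zc] by (intro psd_cone_add psd_cone_scaleR) auto
  then have "d *\<^sub>R W \<in> psd_cone UNIV" using d by (intro psd_cone_scaleR) auto
  then have dW: "d *\<^sub>R W \<in> psd_cone E"
    unfolding psd_cone_iff[of "d *\<^sub>R W" E] using W_off by simp
  have "X - d *\<^sub>R W = (c - d * t) *\<^sub>R Y + (X' - Z) + (1 - d) *\<^sub>R Z"
    by (simp add: W_def X'_def algebra_simps)
  also have "\<dots> \<in> psd_cone UNIV"
    using d Y_psd psd_cone_UNIV_D[OF Zc] psd_cone_UNIV_D[OF Z(2)]
    by (intro psd_cone_add psd_cone_scaleR) auto
  finally have diff: "X - d *\<^sub>R W \<in> psd_cone E"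
    unfolding psd_cone_iff[of "X - d *\<^sub>R W" E] using W_off psd_cone_offpattern[OF X] by simp
  have "0 < W $ v $ v" using t pos by (simp add: W_def Yij Zv)
  then have "W \<noteq> 0" by auto
  then have "d *\<^sub>R W \<noteq> 0" using d by simp
  then obtain k where k: "X = k *\<^sub>R (d *\<^sub>R W)" "0 < k" by (rule extremalD[OF ext dW diff])
  have "X = (k * d) *\<^sub>R (t *\<^sub>R outer (column v X) + Z)"
    unfolding Y_def[symmetric] W_def[symmetric] using k(1) by simp
  moreover have "X $ i $ i \<noteq> 0" if "Z $ i $ i \<noteq> 0" for i
  proof -
    have "0 < X' $ i $ i" using Z_le[of i] that by linarith
    moreover have "X' $ i $ i \<le> X $ i $ i" using c(1) by (simp add: X'_def Yij)
    ultimately show ?thesis by linarith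
  qed
  moreover have "Z $ u $ w \<noteq> 0" using Z(3) by auto
  ultimately show ?thesis using that[OF Z(1) _ _ Zv] k(2) d(1) by (metis mult_pos_pos)
qed

text \<open>The matrix size is fixed by the type, so the induction shrinks \<open>V\<close> and
  keeps the support inside it. The first alternative covers supports in a single vertex or pair,
  where there may be no cycle at all. The rank is bounded only from above here.\<close>

lemma extremal_support:
  fixes E :: "'n::finite set set"
  assumes "simple_graph (V, E)" "series_parallel (V, E)" "extremal E X"
    and "\<And>i. X $ i $ i \<noteq> 0 \<Longrightarrow> i \<in> V"
  shows "card {i. X $ i $ i \<noteq> 0} \<le> 2 \<or>
    (\<exists>vs. chordless_cycle E vs \<and> {i. X $ i $ i \<noteq> 0} \<subseteq> set vs \<and> rank X \<le> length vs - 2)"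
  using assms
proof (induction "card V" arbitrary: V E X rule: less_induct)
  case less
  note G = less.prems(1) and sp = less.prems(2) and ext = less.prems(3) and supp = less.prems(4)
  note X = extremal_cone[OF ext]
  obtain i where "0 < X $ i $ i" using psd_nonzero_diag[OF X extremal_nonzero[OF ext]] .
  then have "V \<noteq> {}" using supp[of i] by auto
  then obtain v where v: "v \<in> V" "card (nbrs E v) \<le> 2"
    using series_parallel_degree_le_2[OF G sp] by blast
  have smaller: "card (V - {v}) < card V" using v(1) by (intro psubset_card_mono) auto
  show ?case
  proof (cases "X $ v $ v = 0")
    case True
    have "has_minor (V, E) (V - {v}, {e \<in> E. v \<notin> e})"
      using v(1) by (intro minor_delete_vertex minor_refl)
    then have "series_parallel (V - {v}, {e \<in> E. v \<notin> e})" using series_parallel_minor sp by blast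
    moreover have "i \<in> V - {v}" if "X $ i $ i \<noteq> 0" for i using supp[OF that] that True by auto
    ultimately show ?thesis
      using less.hyps[OF smaller simple_graph_delete[OF G] _ extremal_delete_vertex[OF ext True]]
        chordless_cycle_delete[of E v] by blast
  next
    case Xvv: False
    have Xv: "x \<in> nbrs E v" if "X $ x $ v \<noteq> 0" "x \<noteq> v" for x
    proof -
      have "{x, v} \<in> E" using psd_cone_offpattern[OF X that(2)] that(1) by blast
      then show ?thesis by (simp add: nbrs_def insert_commute)
    qed
    show ?thesis
    proof (cases "\<forall>u w. u \<noteq> w \<longrightarrow> u \<noteq> v \<longrightarrow> w \<noteq> v \<longrightarrow> X $ u $ v \<noteq> 0 \<longrightarrow> X $ w $ v \<noteq> 0 \<longrightarrow> {u, w} \<in> E")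
      \<comment> \<open>The support lies in \<open>v\<close> and its at most two neighbours: it has
        at most two vertices, or two adjacent neighbours close a triangle.\<close>
      case True
      then obtain k where k: "X = k *\<^sub>R outer (column v X)"
        using extremal_simplicial[OF ext Xvv] by metis
      have r: "rank X = 1" using rank_outer[OF k extremal_nonzero[OF ext]] .
      have sub: "{i. X $ i $ i \<noteq> 0} \<subseteq> insert v {i. i \<noteq> v \<and> X $ i $ v \<noteq> 0}" (is "?S \<subseteq> insert v ?N")
        using outer_column_support[OF k] by auto
      have N: "?N \<subseteq> nbrs E v" using Xv by auto
      show ?thesis
      proof (cases "card ?N \<le> 1")
        case True
        have "card ?S \<le> card (insert v ?N)" using sub by (intro card_mono) auto
        also have "\<dots> \<le> 2" using True by (simp add: card_insert_if)
        finally show ?thesis by blast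
      next
        case False
        then have "card ?N = 2" using card_mono[OF _ N] v(2) by simp
        then obtain u w where uw: "?N = {u, w}" "u \<noteq> w" by (auto simp: card_2_iff)
        then have mem: "u \<in> ?N" "w \<in> ?N" by auto
        then have "{v, u} \<in> E" "{v, w} \<in> E" using N by (auto simp: nbrs_def)
        moreover have "{u, w} \<in> E" using True uw(2) mem by blast
        ultimately have "chordless_cycle E [v, u, w]" using chordless_triangle[OF G] by blast
        moreover have "?S \<subseteq> set [v, u, w]" using sub uw(1) by simp
        moreover have "rank X \<le> length [v, u, w] - 2" using r by simp
        ultimately show ?thesis by blast
      qed
    next
      case False
      then obtain u w where uw: "u \<noteq> w" "u \<noteq> v" "w \<noteq> v" "X $ u $ v \<noteq> 0" "X $ w $ v \<noteq> 0" "{u, w} \<notin> E"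
        by blast
      have "{u, w} \<subseteq> nbrs E v" using Xv uw by auto
      then have N: "nbrs E v = {u, w}" using v(2) uw(1) card_seteq[of "nbrs E v" "{u, w}"] by simp
      let ?E = "insert {u, w} {e \<in> E. v \<notin> e}"
      have uV: "u \<in> V" and Evu: "{u, v} \<in> E"
        using N nbrs_subset[OF G, of v] by (auto simp: nbrs_def insert_commute)
      have ct: "contract E u v = ?E" using contract_degree_two[OF G N uw(1)] .
      have "has_minor (V, E) (V - {v}, ?E)" using has_minor_contract[OF Evu uw(2)] unfolding ct .
      then have sp': "series_parallel (V - {v}, ?E)" using series_parallel_minor sp by blast
      have G': "simple_graph (V - {v}, ?E)" using simple_graph_contract[OF G uw(2) uV] unfolding ct .
      obtain Z k t where Z: "extremal ?E Z" "Z $ u $ w \<noteq> 0"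
        "\<And>i. Z $ i $ i \<noteq> 0 \<Longrightarrow> X $ i $ i \<noteq> 0" "Z $ v $ v = 0" "0 < k"
        "X = k *\<^sub>R (t *\<^sub>R outer (column v X) + Z)"
        using extremal_eliminate_degree_two[OF ext N uw(1,6,4,5)] by blast
      note Zc = extremal_cone[OF Z(1)]
      have Zuw: "Z $ u $ u \<noteq> 0" "Z $ w $ w \<noteq> 0" using psd_diag_zero[OF Zc] Z(2) by blast+
      have suppZ: "i \<in> V - {v}" if "Z $ i $ i \<noteq> 0" for i
        using supp[OF Z(3)[OF that]] that Z(4) by auto
      \<comment> \<open>A vertex of the support of \<open>X\<close> outside that of \<open>Z\<close>
        has a nonzero entry in column \<open>v\<close>, hence is \<open>v\<close>, \<open>u\<close>
        or \<open>w\<close>; the last two do belong to the support of \<open>Z\<close>.\<close>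
      have suppX: "i = v \<or> Z $ i $ i \<noteq> 0" if "X $ i $ i \<noteq> 0" for i
      proof (rule ccontr)
        assume *: "\<not> ?thesis"
        then have "X $ i $ i = k * (t * (X $ i $ v)\<^sup>2)"
          using arg_cong[OF Z(6), of "\<lambda>A. A $ i $ i"] by (simp add: column_nth power2_eq_square)
        then have "X $ i $ v \<noteq> 0" using that by auto
        then have "i \<in> {u, w}" using Xv[of i] N * by auto
        then show False using Zuw * by auto
      qed
      from less.hyps[OF smaller G' sp' Z(1) suppZ]
      consider "card {i. Z $ i $ i \<noteq> 0} \<le> 2" | vs where "chordless_cycle ?E vs"
          "{i. Z $ i $ i \<noteq> 0} \<subseteq> set vs" "rank Z \<le> length vs - 2" by blast
      then show ?thesis
      proof cases
        \<comment> \<open>Impossible: \<open>X\<close> would live on the path from \<open>u\<close>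
          over \<open>v\<close> to \<open>w\<close>, where the end vertex \<open>u\<close> has one
          neighbour. That makes \<open>X\<close> a rank one matrix vanishing at
          \<open>w\<close>.\<close>
        case 1
        have "{u, w} \<subseteq> {i. Z $ i $ i \<noteq> 0}" using Zuw by auto
        then have eq: "{i. Z $ i $ i \<noteq> 0} = {u, w}"
          using 1 uw(1) card_seteq[of "{i. Z $ i $ i \<noteq> 0}" "{u, w}"] by simp
        have only: "x = v" if "X $ x $ u \<noteq> 0" "x \<noteq> u" for x
        proof -
          have "X $ x $ x \<noteq> 0" using psd_diag_zero(1)[OF X, of x u] that(1) by blast
          moreover have "x \<noteq> w"
            using that(1) psd_cone_offpattern[OF X uw(1,6)] psd_cone_sym[OF X, of u w] by auto
          ultimately show ?thesis using suppX[of x] eq that(2) by auto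
        qed
        have "X $ u $ u \<noteq> 0" using Z(3) Zuw by blast
        then obtain l where "X = l *\<^sub>R outer (column u X)"
          using extremal_simplicial[OF ext, of u] only by metis
        then have "X $ w $ u \<noteq> 0" using outer_column_support Z(3) Zuw by blast
        then show ?thesis using only uw by metis
      next
        case 2
        have "{u, w} \<in> ?E" "{u, w} \<subseteq> set vs" using 2(2) Zuw by auto
        then obtain us where us: "chordless_cycle ?E us" "set us = set vs" "length us = length vs"
            "{last us, hd us} = {u, w}"
          by (rule chordless_cycle_closing_edge[OF 2(1)])
        have "chordless_cycle E (us @ [v])"
          using chordless_cycle_subdivide(1)[OF G N uw(6) _ _ us(1,4)] uw by auto
        moreover have "{i. X $ i $ i \<noteq> 0} \<subseteq> set (us @ [v])" using suppX 2(2) us(2) by auto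
        moreover have "rank X \<le> length (us @ [v]) - 2"
        proof -
          have "rank X = rank (t *\<^sub>R outer (column v X) + Z)"
            using arg_cong[OF Z(6), of rank] rank_scaleR[of k] Z(5) by simp
          also have "\<dots> \<le> 1 + rank Z" by (rule rank_outer_add_le)
          also have "\<dots> \<le> length (us @ [v]) - 2"
            using 2(3) 2(1) us(3) by (auto simp: chordless_cycle_def)
          finally show ?thesis .
        qed
        ultimately show ?thesis by blast
      qed
    qed
  qed
qed


section \<open>Ranks of extremal matrices\<close>

lemma cycle_edges_index:
  assumes "distinct vs" "i < length vs" "j < length vs" "i \<noteq> j" "{vs ! i, vs ! j} \<in> cycle_edges vs"
  shows "j = Suc i mod length vs \<or> i = Suc j mod length vs"
proof -
  obtain k where k: "k < length vs" "{vs ! i, vs ! j} = {vs ! k, vs ! (Suc k mod length vs)}"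
    using assms(5) by (auto simp: cycle_edges_def)
  moreover have "Suc k mod length vs < length vs" using k(1) by (intro mod_less_divisor) linarith
  ultimately show ?thesis
    using assms(1-4) by (auto simp: doubleton_eq_iff nth_eq_iff_index_eq)
qed

lemma psd_cone_cycle_zero:
  assumes C: "chordless_cycle E vs" and X: "X \<in> psd_cone E"
    and i: "i < length vs" "j < length vs" "i \<noteq> j"
    and nz: "X $ (vs ! i) $ (vs ! j) \<noteq> 0"
  shows "j = Suc i mod length vs \<or> i = Suc j mod length vs"
proof -
  have d: "distinct vs" using C by (simp add: chordless_cycle_def)
  then have "vs ! i \<noteq> vs ! j" using i by (simp add: nth_eq_iff_index_eq)
  then have "{vs ! i, vs ! j} \<in> E" using psd_cone_offpattern[OF X] nz by blast
  moreover have "{vs ! i, vs ! j} \<subseteq> set vs" using i by auto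
  ultimately have "{vs ! i, vs ! j} \<in> cycle_edges vs"
    using C unfolding chordless_cycle_def by blast
  then show ?thesis using cycle_edges_index[OF d i] by blast
qed

lemma psd_cone_cycle_zero_less:
  assumes "chordless_cycle E vs" "X \<in> psd_cone E" "i < j" "j < length vs" "j \<noteq> Suc i"
    "i \<noteq> 0 \<or> Suc j \<noteq> length vs"
  shows "X $ (vs ! i) $ (vs ! j) = 0" "X $ (vs ! j) $ (vs ! i) = 0"
proof -
  have "\<not> (j = Suc i mod length vs \<or> i = Suc j mod length vs)"
    using assms(3-6) by (auto simp: mod_Suc)
  then show "X $ (vs ! i) $ (vs ! j) = 0"
    using psd_cone_cycle_zero[OF assms(1,2), of i j] assms(3,4) by auto
  then show "X $ (vs ! j) $ (vs ! i) = 0" using psd_cone_sym[OF assms(2)] by metis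
qed

lemma sum_over_distinct_list:
  fixes f :: "'n::finite \<Rightarrow> real"
  assumes "distinct vs" "\<And>x. x \<notin> set vs \<Longrightarrow> f x = 0"
  shows "(\<Sum>x\<in>UNIV. f x) = (\<Sum>i<length vs. f (vs ! i))"
proof -
  have "(\<Sum>x\<in>UNIV. f x) = (\<Sum>x\<in>set vs. f x)" using assms(2) by (intro sum.mono_neutral_right) auto
  also have "\<dots> = (\<Sum>i<length vs. f (vs ! i))"
    using bij_betw_nth[OF assms(1) refl refl] by (intro sum.reindex_bij_betw[symmetric])
  finally show ?thesis .
qed

text \<open>\<open>X\<close> is injective on the vectors supported on the cycle without its first
  and last vertex. For such a vector the closing edge plays no part, and the rows along the path
  form a triangular system: row \<open>k\<close> determines the coordinate at \<open>k + 1\<close>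
  from the previous ones.\<close>

lemma rank_ge_of_cycle:
  assumes C: "chordless_cycle E vs" and X: "X \<in> psd_cone E"
    and nz: "\<And>i. Suc i < length vs \<Longrightarrow> X $ (vs ! i) $ (vs ! Suc i) \<noteq> 0"
  shows "length vs - 2 \<le> rank X"
proof -
  have d: "distinct vs" using C by (simp add: chordless_cycle_def)
  define I where "I = (\<lambda>i. vs ! i) ` {1..<length vs - 1}"
  define S where "S = {x :: real^'a. \<forall>i. i \<notin> I \<longrightarrow> x $ i = 0}"
  have "card I = length vs - 2"
    unfolding I_def using d by (subst card_image) (auto simp: inj_on_def nth_eq_iff_index_eq)
  then have dimS: "dim S = length vs - 2" unfolding S_def dim_vec_eq[symmetric] dim_substandard_cart .
  have sub: "subspace S" by (auto simp: S_def subspace_def)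
  have ker: "x = 0" if x: "x \<in> S" "X *v x = 0" for x
  proof -
    have xI: "x $ l = 0" if "l \<notin> I" for l using x(1) that by (simp add: S_def)
    have x0: "x $ (vs ! i) = 0" if "i < length vs - 1" for i
      using that
    proof (induction i rule: less_induct)
      case (less i)
      show ?case
      proof (cases i)
        case 0
        have "vs ! i \<notin> I"
        proof
          assume "vs ! i \<in> I"
          then obtain j where j: "1 \<le> j" "j < length vs - 1" "vs ! i = vs ! j" by (auto simp: I_def)
          then have "i < length vs" "j < length vs" using less.prems by linarith+
          then have "i = j" using nth_eq_iff_index_eq[OF d] j(3) by blast
          then show False using j(1) 0 by simp
        qed
        then show ?thesis by (rule xI)
      next
        case (Suc k)
        define r where "r = X $ (vs ! k) $ (vs ! i) * x $ (vs ! i)"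
        have "X $ (vs ! k) $ l * x $ l = (if l = vs ! i then r else 0)" for l
        proof (cases "l \<in> I")
          case True
          then obtain j where j: "1 \<le> j" "j < length vs - 1" "l = vs ! j" by (auto simp: I_def)
          consider "j < i" | "j = i" | "i < j" by linarith
          then show ?thesis
          proof cases
            case 1
            then show ?thesis using less.IH[of j] j less.prems d
              by (auto simp: nth_eq_iff_index_eq)
          next
            case 3
            then have "X $ (vs ! k) $ (vs ! j) = 0"
              using j Suc by (intro psd_cone_cycle_zero_less(1)[OF C X]) auto
            then show ?thesis using 3 j d less.prems by (auto simp: nth_eq_iff_index_eq)
          qed (use j in \<open>auto simp: r_def\<close>)
        qed (use xI in \<open>auto simp: r_def\<close>)
        then have "(X *v x) $ (vs ! k) = r"
          by (simp add: matrix_vector_mult_def)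
        then have "X $ (vs ! k) $ (vs ! i) * x $ (vs ! i) = 0" using x(2) by (simp add: r_def)
        moreover have "X $ (vs ! k) $ (vs ! i) \<noteq> 0" using nz[of k] Suc less.prems by simp
        ultimately show ?thesis by simp
      qed
    qed
    have "x $ l = 0" for l
    proof (cases "l \<in> I")
      case True
      then show ?thesis using x0 by (auto simp: I_def)
    qed (use xI in auto)
    then show ?thesis by (simp add: vec_eq_iff)
  qed
  have "inj_on ((*v) X) S"
  proof (rule inj_onI)
    fix x y assume xy: "x \<in> S" "y \<in> S" "X *v x = X *v y"
    then have "X *v (x - y) = 0" by (simp add: matrix_vector_mult_diff_distrib)
    then show "x = y" using ker[of "x - y"] subspace_diff[OF sub xy(1,2)] by simp
  qed
  moreover have "span S = S" using sub by simp
  ultimately have "inj_on ((*v) X) (span S)" by (simp only:)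
  then have "dim ((*v) X ` S) = dim S"
    by (intro dim_image_eq matrix_vector_mul_linear)
  moreover have "dim ((*v) X ` S) \<le> rank X"
    unfolding rank_dim_range by (intro dim_subset) auto
  ultimately show ?thesis using dimS by simp
qed

text \<open>If a support vertex has a zero entry to its successor, at most its predecessor is joined
  to it and \<open>extremal_simplicial\<close> applies. Otherwise nonvanishing travels: a nonzero
  edge entry makes the next diagonal entry nonzero, so the whole cycle is in the support.\<close>

lemma extremal_rank_cycle_cases:
  assumes C: "chordless_cycle E vs" and ext: "extremal E X"
    and supp: "\<And>i. X $ i $ i \<noteq> 0 \<Longrightarrow> i \<in> set vs"
  shows "rank X = 1 \<or> length vs - 2 \<le> rank X"
proof -
  note X = extremal_cone[OF ext]
  let ?n = "length vs"
  have n: "3 \<le> ?n" using C by (simp add: chordless_cycle_def)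
  show ?thesis
  proof (cases "\<exists>i<?n. X $ (vs ! i) $ (vs ! i) \<noteq> 0 \<and> X $ (vs ! i) $ (vs ! (Suc i mod ?n)) = 0")
    case True
    then obtain i where i: "i < ?n" "X $ (vs ! i) $ (vs ! i) \<noteq> 0"
        "X $ (vs ! i) $ (vs ! (Suc i mod ?n)) = 0" by blast
    have pred: "\<exists>j. j < ?n \<and> u = vs ! j \<and> i = Suc j mod ?n"
      if u: "u \<noteq> vs ! i" "X $ u $ (vs ! i) \<noteq> 0" for u
    proof -
      have "X $ u $ u \<noteq> 0" using psd_diag_zero(1)[OF X, of u "vs ! i"] u(2) by auto
      then obtain j where j: "j < ?n" "u = vs ! j" using supp by (metis in_set_conv_nth)
      then have "j = Suc i mod ?n \<or> i = Suc j mod ?n"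
        using psd_cone_cycle_zero[OF C X, of i j] u i(1) psd_cone_sym[OF X, of u] by auto
      moreover have "j \<noteq> Suc i mod ?n" using i(3) j u(2) psd_cone_sym[OF X, of u] by auto
      ultimately show ?thesis using j by blast
    qed
    have "u = w" if uw: "u \<noteq> vs ! i" "w \<noteq> vs ! i" "X $ u $ (vs ! i) \<noteq> 0" "X $ w $ (vs ! i) \<noteq> 0"
      for u w
    proof -
      obtain j k where "j < ?n" "u = vs ! j" "i = Suc j mod ?n" "k < ?n" "w = vs ! k" "i = Suc k mod ?n"
        using pred[OF uw(1,3)] pred[OF uw(2,4)] by blast
      then have "j = k" by (auto simp: mod_Suc split: if_splits)
      then show ?thesis using \<open>u = vs ! j\<close> \<open>w = vs ! k\<close> by simp
    qed
    then obtain k where "X = k *\<^sub>R outer (column (vs ! i) X)"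
      using extremal_simplicial[OF ext i(2)] by metis
    then show ?thesis using rank_outer extremal_nonzero[OF ext] by blast
  next
    case False
    then have nz: "X $ (vs ! i) $ (vs ! (Suc i mod ?n)) \<noteq> 0"
      if "i < ?n" "X $ (vs ! i) $ (vs ! i) \<noteq> 0" for i using that by blast
    obtain a where "0 < X $ a $ a" using psd_nonzero_diag[OF X extremal_nonzero[OF ext]] .
    then obtain p where p: "p < ?n" "X $ (vs ! p) $ (vs ! p) \<noteq> 0"
      using supp[of a] by (auto simp: in_set_conv_nth)
    have lt: "k mod ?n < ?n" for k using n by (intro mod_less_divisor) linarith
    have around: "X $ (vs ! ((p + k) mod ?n)) $ (vs ! ((p + k) mod ?n)) \<noteq> 0" for k
    proof (induction k)
      case 0
      then show ?case using p by simp
    next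
      case (Suc k)
      then have "X $ (vs ! (Suc ((p + k) mod ?n) mod ?n)) $ (vs ! (Suc ((p + k) mod ?n) mod ?n)) \<noteq> 0"
        using nz[OF lt Suc] psd_diag_zero(2)[OF X] by blast
      then show ?case by (simp add: mod_simps)
    qed
    have "X $ (vs ! i) $ (vs ! i) \<noteq> 0" if "i < ?n" for i
    proof -
      \<comment> \<open>The number of steps from \<open>p\<close> to \<open>i\<close>, increased by
        the cycle length where necessary to stay within natural numbers.\<close>
      have "p + (i + (?n - p)) = i + ?n" using p(1) by simp
      then have "(p + (i + (?n - p))) mod ?n = i" using that by simp
      then show ?thesis using around[of "i + (?n - p)"] by simp
    qed
    then have "length vs - 2 \<le> rank X"
      using nz by (intro rank_ge_of_cycle[OF C X]) (metis Suc_lessD mod_less)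
    then show ?thesis ..
  qed
qed

lemma extremal_card_le_2_rank:
  assumes ext: "extremal E X" and card: "card {i. X $ i $ i \<noteq> 0} \<le> 2"
  shows "rank X = 1"
proof -
  note X = extremal_cone[OF ext]
  obtain v where v: "0 < X $ v $ v" using psd_nonzero_diag[OF X extremal_nonzero[OF ext]] .
  have "u = w" if "u \<noteq> v" "w \<noteq> v" "X $ u $ v \<noteq> 0" "X $ w $ v \<noteq> 0" for u w
  proof (rule ccontr)
    assume "u \<noteq> w"
    have "X $ u $ u \<noteq> 0" "X $ w $ w \<noteq> 0" using psd_diag_zero(1)[OF X] that by blast+
    then have "card {u, v, w} \<le> card {i. X $ i $ i \<noteq> 0}" using v by (intro card_mono) auto
    then show False using card that \<open>u \<noteq> w\<close> by auto
  qed
  then obtain k where "X = k *\<^sub>R outer (column v X)"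
    using extremal_simplicial[OF ext, of v] v by (metis less_irrefl)
  then show ?thesis using rank_outer extremal_nonzero[OF ext] by blast
qed

text \<open>
  The quadratic form of the following matrix is
  \<open>\<Sum>i<m-1. (x\<^sub>i\<^sub>+\<^sub>1 - x\<^sub>i)\<^sup>2 - (x\<^sub>m\<^sub>-\<^sub>1 - x\<^sub>0)\<^sup>2 / (m - 1)\<close>. It is nonnegative by the Cauchy-Schwarz
  inequality, and it vanishes exactly at the arithmetic progressions along the cycle. They also lie in
  the kernel of every matrix below it in the cone, which fixes such a matrix up to a factor.
\<close>

definition edge_diff :: "'n::finite list \<Rightarrow> nat \<Rightarrow> nat \<Rightarrow> real^'n" where
  "edge_diff vs i j = axis (vs ! j) 1 - axis (vs ! i) 1"

definition cycle_matrix :: "'n::finite list \<Rightarrow> real^'n^'n" where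
  "cycle_matrix vs = (\<Sum>i<length vs - 1. outer (edge_diff vs i (Suc i)))
     - (1 / real (length vs - 1)) *\<^sub>R outer (edge_diff vs 0 (length vs - 1))"

lemma edge_diff_inner: "edge_diff vs i j \<bullet> x = x $ (vs ! j) - x $ (vs ! i)"
  by (simp add: edge_diff_def inner_diff_left inner_axis')

lemma edge_diff_nth: "edge_diff vs i j $ l = (if l = vs ! j then 1 else 0) - (if l = vs ! i then 1 else 0)"
  by (simp add: edge_diff_def axis_def)

lemma sum_edge_diff: "(\<Sum>i<n. edge_diff vs i (Suc i)) = edge_diff vs 0 n"
  by (induction n) (simp_all add: edge_diff_def)

lemma sum_matrix_vector_mult: "(\<Sum>i\<in>I. A i) *v x = (\<Sum>i\<in>I. A i *v (x :: real^'n))"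
  by (induction I rule: infinite_finite_induct) (simp_all add: matrix_vector_mult_add_rdistrib)

lemma cycle_matrix_mult:
  "cycle_matrix vs *v x =
     (\<Sum>i<length vs - 1. (x $ (vs ! Suc i) - x $ (vs ! i)) *\<^sub>R edge_diff vs i (Suc i))
     - ((x $ (vs ! (length vs - 1)) - x $ (vs ! 0)) / real (length vs - 1)) *\<^sub>R
       edge_diff vs 0 (length vs - 1)"
  by (simp add: cycle_matrix_def matrix_vector_mult_diff_rdistrib sum_matrix_vector_mult outer_mult
      edge_diff_inner scaleR_matrix_vector_assoc[symmetric])

lemma cycle_matrix_form:
  "x \<bullet> (cycle_matrix vs *v x) =
     (\<Sum>i<length vs - 1. (x $ (vs ! Suc i) - x $ (vs ! i))\<^sup>2)
     - (x $ (vs ! (length vs - 1)) - x $ (vs ! 0))\<^sup>2 / real (length vs - 1)"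
  by (simp add: cycle_matrix_mult inner_diff_right inner_sum_right inner_commute[of x] edge_diff_inner
      power2_eq_square)

text \<open>The origin of the weight 1 / (m - 1): constant increments c telescope to c times the
  closing difference, and the total increment divided by m - 1 is again c, so both terms
  cancel.\<close>

lemma cycle_matrix_progression:
  assumes x: "\<And>i. i < length vs - 1 \<Longrightarrow> x $ (vs ! Suc i) - x $ (vs ! i) = c" and "2 \<le> length vs"
  shows "cycle_matrix vs *v x = 0"
proof -
  have "x $ (vs ! (length vs - 1)) - x $ (vs ! 0) = (\<Sum>i<length vs - 1. x $ (vs ! Suc i) - x $ (vs ! i))"
    by (simp add: sum_lessThan_telescope[of "\<lambda>i. x $ (vs ! i)"])
  also have "\<dots> = real (length vs - 1) * c" using x by simp
  finally have "(x $ (vs ! (length vs - 1)) - x $ (vs ! 0)) / real (length vs - 1) = c"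
    using assms(2) by simp
  moreover have "(\<Sum>i<length vs - 1. (x $ (vs ! Suc i) - x $ (vs ! i)) *\<^sub>R edge_diff vs i (Suc i)) =
      c *\<^sub>R edge_diff vs 0 (length vs - 1)"
    using x by (simp add: scaleR_sum_right[symmetric] sum_edge_diff)
  ultimately show ?thesis unfolding cycle_matrix_mult by simp
qed

lemma cycle_matrix_psd:
  assumes C: "chordless_cycle E vs"
  shows "cycle_matrix vs \<in> psd_cone E"
proof -
  let ?n = "length vs - 1"
  have n: "3 \<le> length vs" using C by (simp add: chordless_cycle_def)
  have "0 \<le> x \<bullet> (cycle_matrix vs *v x)" for x
  proof -
    have "(x $ (vs ! ?n) - x $ (vs ! 0))\<^sup>2 = (\<Sum>i<?n. x $ (vs ! Suc i) - x $ (vs ! i))\<^sup>2"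
      by (simp add: sum_lessThan_telescope[of "\<lambda>i. x $ (vs ! i)"])
    also have "\<dots> \<le> (\<Sum>i<?n. (x $ (vs ! Suc i) - x $ (vs ! i))\<^sup>2) * real ?n"
      using sum_squared_le_sum_of_squares[of "\<lambda>i. x $ (vs ! Suc i) - x $ (vs ! i)" "{..<?n}"] by simp
    finally show ?thesis unfolding cycle_matrix_form using n by (simp add: divide_le_eq)
  qed
  then have psd: "cycle_matrix vs \<in> psd_cone UNIV"
    by (intro psd_cone_UNIV_I) (simp_all add: cycle_matrix_def mult.commute)
  have edge: "edge_diff vs k l $ i * edge_diff vs k l $ j = 0"
    if "i \<noteq> j" "{i, j} \<notin> E" "{vs ! k, vs ! l} \<in> E" for i j k l
    using that by (auto simp: edge_diff_nth insert_commute)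
  have E: "{vs ! i, vs ! Suc i} \<in> E" if "i < ?n" for i
  proof -
    have "Suc i mod length vs = Suc i" "i < length vs" using that by auto
    then have "{vs ! i, vs ! Suc i} \<in> cycle_edges vs" unfolding cycle_edges_def mem_Collect_eq by metis
    then show ?thesis using C by (auto simp: chordless_cycle_def)
  qed
  have "{vs ! ?n, vs ! (Suc ?n mod length vs)} \<in> cycle_edges vs" "Suc ?n = length vs"
    using n unfolding cycle_edges_def by auto
  then have E0: "{vs ! 0, vs ! ?n} \<in> E" using C by (auto simp: chordless_cycle_def insert_commute)
  show ?thesis
    unfolding psd_cone_iff[of "cycle_matrix vs" E]
  proof (intro conjI psd allI impI)
    fix i j assume ij: "i \<noteq> j" "{i, j} \<notin> E"
    then have "(\<Sum>k<?n. edge_diff vs k (Suc k) $ i * edge_diff vs k (Suc k) $ j) = 0"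
      using edge E by (intro sum.neutral) blast
    then show "cycle_matrix vs $ i $ j = 0"
      using edge[OF ij E0] by (simp add: cycle_matrix_def)
  qed
qed

lemma cycle_matrix_edge:
  assumes d: "distinct vs" and n: "3 \<le> length vs" and i: "Suc i < length vs"
  shows "cycle_matrix vs $ (vs ! i) $ (vs ! Suc i) = - 1"
proof -
  let ?n = "length vs - 1"
  have "edge_diff vs k (Suc k) $ (vs ! i) * edge_diff vs k (Suc k) $ (vs ! Suc i) =
      (if k = i then - 1 else 0)" if "k < ?n" for k
    using that d i by (auto simp: edge_diff_nth nth_eq_iff_index_eq)
  then have "(\<Sum>k<?n. edge_diff vs k (Suc k) $ (vs ! i) * edge_diff vs k (Suc k) $ (vs ! Suc i)) =
      (\<Sum>k<?n. if k = i then - 1 else 0)"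
    by (intro sum.cong) auto
  also have "\<dots> = - 1" using i by simp
  finally have sum: "(\<Sum>k<?n. edge_diff vs k (Suc k) $ (vs ! i) * edge_diff vs k (Suc k) $ (vs ! Suc i)) = - 1" .
  have pos: "0 < length vs" "?n < length vs" using n by linarith+
  then have "vs ! Suc i \<noteq> vs ! 0" using nth_eq_iff_index_eq[OF d i, of 0] by simp
  moreover have "vs ! i \<noteq> vs ! ?n" using d i nth_eq_iff_index_eq[OF d, of i ?n] by auto
  moreover have "vs ! i \<noteq> vs ! 0 \<or> vs ! Suc i \<noteq> vs ! ?n"
    using nth_eq_iff_index_eq[OF d _ pos(1), of i] nth_eq_iff_index_eq[OF d i pos(2)] i n
    by (cases "i = 0") simp_all
  ultimately have "edge_diff vs 0 ?n $ (vs ! i) * edge_diff vs 0 ?n $ (vs ! Suc i) = 0"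
    by (auto simp: edge_diff_nth)
  then show ?thesis using sum by (simp add: cycle_matrix_def)
qed

text \<open>One edge entry determines the matrix. Progressions vanishing at a vertex eliminate its
  diagonal entry, so its row passes a zero from one edge to the next; \<open>D01\<close> starts this
  along the path, then row 0 yields the closing edge, and finally the diagonal follows.\<close>

lemma cycle_pattern_kernel:
  assumes C: "chordless_cycle E vs" and sym: "\<And>i j. D $ i $ j = D $ j $ i"
    and off: "\<And>i j. i \<noteq> j \<Longrightarrow> {i, j} \<notin> E \<Longrightarrow> D $ i $ j = 0"
    and ker: "\<And>x c. (\<And>i. i < length vs - 1 \<Longrightarrow> x $ (vs ! Suc i) - x $ (vs ! i) = c) \<Longrightarrow> D *v x = 0"
    and D01: "D $ (vs ! 0) $ (vs ! 1) = 0"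
  shows "D = (0 :: real^'n::finite^'n)"
proof -
  let ?n = "length vs"
  have n: "3 \<le> ?n" and d: "distinct vs" using C by (auto simp: chordless_cycle_def)
  have out: "D $ i $ w = 0" "D $ w $ i = 0" if "w \<notin> set vs" for i w
  proof -
    have "vs ! j \<noteq> w" if "j < ?n" for j using that \<open>w \<notin> set vs\<close> by (metis nth_mem)
    \<comment> \<open>A unit vector off the cycle is constant on the cycle, a progression with
      difference zero.\<close>
    then have "D *v axis w 1 = 0" using n by (intro ker[where c = 0]) (auto simp: axis_def)
    then have "column w D $ i = 0" by (simp add: matrix_vector_mult_basis)
    then show "D $ i $ w = 0" by (simp add: column_nth)
    then show "D $ w $ i = 0" using sym[of w i] by simp
  qed
  define a where "a i j = D $ (vs ! i) $ (vs ! j)" for i j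
  have a_sym: "a i j = a j i" for i j using sym by (simp add: a_def)
  have a_off: "a i j = 0" if "i < j" "j < ?n" "j \<noteq> Suc i" "i \<noteq> 0 \<or> Suc j \<noteq> ?n" for i j
  proof (rule ccontr)
    assume nz: "a i j \<noteq> 0"
    have "vs ! i \<noteq> vs ! j" using that d by (simp add: nth_eq_iff_index_eq)
    then have "{vs ! i, vs ! j} \<in> E" using off[of "vs ! i" "vs ! j"] nz by (auto simp: a_def)
    moreover have "{vs ! i, vs ! j} \<subseteq> set vs" using that by auto
    ultimately have "{vs ! i, vs ! j} \<in> cycle_edges vs"
      using C unfolding chordless_cycle_def by blast
    then have "j = Suc i mod ?n \<or> i = Suc j mod ?n"
      using cycle_edges_index[OF d, of i j] that by auto
    then show False using that by (auto simp: mod_Suc split: if_splits)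
  qed
  \<comment> \<open>The shift \<open>s\<close> moves the zero of the progression; each choice
    removes a different unknown from the row.\<close>
  have row: "(\<Sum>j<?n. a i j * (real j - s)) = 0" if "i < ?n" for i s
  proof -
    define x :: "real^'n" where "x = (\<chi> l. \<Sum>j<?n. if l = vs ! j then real j - s else 0)"
    have xj: "x $ (vs ! j) = real j - s" if "j < ?n" for j
    proof -
      have "x $ (vs ! j) = (\<Sum>k<?n. if k = j then real k - s else 0)"
        unfolding x_def vec_lambda_beta
        using that d by (intro sum.cong) (auto simp: nth_eq_iff_index_eq)
      then show ?thesis using that by simp
    qed
    have "D *v x = 0" by (rule ker[where c = 1]) (simp add: xj)
    then have "(\<Sum>l\<in>UNIV. D $ (vs ! i) $ l * x $ l) = 0"
      by (metis (no_types) matrix_vector_mult_def vec_lambda_beta zero_index)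
    also have "(\<Sum>l\<in>UNIV. D $ (vs ! i) $ l * x $ l) = (\<Sum>j<?n. D $ (vs ! i) $ (vs ! j) * x $ (vs ! j))"
      using out by (intro sum_over_distinct_list[OF d]) simp
    also have "\<dots> = (\<Sum>j<?n. a i j * (real j - s))" by (intro sum.cong) (simp_all add: a_def xj)
    finally show ?thesis .
  qed
  have path: "a i (Suc i) = 0" if "Suc i < ?n" for i
    using that
  proof (induction i)
    case 0
    then show ?case using D01 by (simp add: a_def)
  next
    case (Suc i)
    have "a (Suc i) j * (real j - real (Suc i)) = (if j = Suc (Suc i) then a (Suc i) (Suc (Suc i)) else 0)"
      if "j < ?n" for j
    proof -
      consider "j < i" | "j = i" | "j = Suc i" | "j = Suc (Suc i)" | "Suc (Suc i) < j" by linarith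
      then show ?thesis
      proof cases
        case 1
        then show ?thesis using a_off[of j "Suc i"] a_sym[of "Suc i" j] Suc.prems by simp
      next
        case 2
        then show ?thesis using Suc a_sym[of "Suc i" i] by simp
      next
        case 5
        then show ?thesis using a_off[of "Suc i" j] that by simp
      qed auto
    qed
    then have "(\<Sum>j<?n. a (Suc i) j * (real j - real (Suc i))) =
        (\<Sum>j<?n. if j = Suc (Suc i) then a (Suc i) (Suc (Suc i)) else 0)"
      by (intro sum.cong) auto
    then show ?case using row[of "Suc i" "real (Suc i)"] Suc.prems by simp
  qed
  define r where "r = a 0 (?n - 1) * real (?n - 1)"
  have "a 0 j * (real j - 0) = (if j = ?n - 1 then r else 0)" if j: "j < ?n" for j
  proof -
    consider "j = 0" | "j = 1" | "1 < j" "j < ?n - 1" | "j = ?n - 1"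
      using j by linarith
    then show ?thesis
    proof cases
      case 2
      then show ?thesis using path[of 0] n by auto
    next
      case 3
      then show ?thesis using a_off[of 0 j] by auto
    qed (auto simp: r_def)
  qed
  then have "(\<Sum>j<?n. a 0 j * (real j - 0)) =
      (\<Sum>j<?n. if j = ?n - 1 then r else 0)"
    by (intro sum.cong) auto
  moreover have pos: "0 < ?n" using n by linarith
  ultimately have "r = 0" using row[OF pos, of 0] by simp
  then have last: "a 0 (?n - 1) = 0" using n by (simp add: r_def)
  have less: "a i j = 0" if "i < j" "j < ?n" for i j
  proof (cases "j = Suc i")
    case True
    then show ?thesis using path that by simp
  next
    case False
    show ?thesis
    proof (cases "i = 0 \<and> Suc j = ?n")
      case True
      then have "j = ?n - 1" by arith
      then show ?thesis using last True by simp
    qed (use a_off that False in blast)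
  qed
  have neq: "a i j = 0" if "i \<noteq> j" "i < ?n" "j < ?n" for i j
    using less[of i j] less[of j i] a_sym[of i j] that by (cases "i < j") auto
  have diag: "a i i = 0" if "i < ?n" for i
  proof -
    \<comment> \<open>All other entries of the row are gone; this shift gives the diagonal entry the
      weight one.\<close>
    have "(\<Sum>j<?n. a i j * (real j - (real i - 1))) = (\<Sum>j<?n. if j = i then a i i else 0)"
      using neq that by (intro sum.cong) auto
    then show ?thesis using row[OF that, of "real i - 1"] that by simp
  qed
  have "D $ k $ l = 0" for k l
  proof (cases "k \<in> set vs \<and> l \<in> set vs")
    case True
    then obtain i j where "i < ?n" "j < ?n" "k = vs ! i" "l = vs ! j" by (auto simp: in_set_conv_nth)
    then show ?thesis using neq[of i j] diag[of i] by (cases "i = j") (auto simp: a_def)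
  qed (use out in auto)
  then show ?thesis by (simp add: vec_eq_iff)
qed

lemma extremal_cycle_matrix:
  assumes C: "chordless_cycle E vs"
  shows "extremal E (cycle_matrix vs)"
proof -
  let ?X = "cycle_matrix vs"
  have n: "3 \<le> length vs" and d: "distinct vs" using C by (auto simp: chordless_cycle_def)
  have X01: "?X $ (vs ! 0) $ (vs ! 1) = - 1" using cycle_matrix_edge[OF d n, of 0] n by simp
  have X: "?X \<in> psd_cone E" using C by (rule cycle_matrix_psd)
  have "\<exists>k. A = k *\<^sub>R ?X" if A: "A \<in> psd_cone E" "?X - A \<in> psd_cone E" for A
  proof -
    \<comment> \<open>The entry of \<open>?X\<close> at this edge is -1, so adding
      \<open>a *\<^sub>R ?X\<close> clears the entry of \<open>A\<close>.\<close>
    define a where "a = A $ (vs ! 0) $ (vs ! 1)"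
    have "A + a *\<^sub>R ?X = 0"
    proof (rule cycle_pattern_kernel[OF C])
      fix i j
      show "(A + a *\<^sub>R ?X) $ i $ j = (A + a *\<^sub>R ?X) $ j $ i"
        using psd_cone_sym[OF A(1), of i j] psd_cone_sym[OF X, of i j] by simp
      show "(A + a *\<^sub>R ?X) $ i $ j = 0" if "i \<noteq> j" "{i, j} \<notin> E"
        using psd_cone_offpattern[OF A(1) that] psd_cone_offpattern[OF X that] by simp
    next
      fix x :: "real^'a" and c assume "\<And>i. i < length vs - 1 \<Longrightarrow> x $ (vs ! Suc i) - x $ (vs ! i) = c"
      then have Xx: "?X *v x = 0" using n by (intro cycle_matrix_progression) auto
      \<comment> \<open>The form of \<open>A\<close> is squeezed between zero and that of
        \<open>?X\<close>, which vanishes at \<open>x\<close>.\<close>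
      then have "x \<bullet> (A *v x) = 0"
        using psd_cone_nonneg[OF A(1), of x] psd_cone_nonneg[OF A(2), of x]
        by (simp add: matrix_vector_mult_diff_rdistrib inner_diff_right)
      then have "A *v x = 0" by (rule psd_kernel[OF A(1)])
      then show "(A + a *\<^sub>R ?X) *v x = 0" using Xx
        by (simp add: matrix_vector_mult_add_rdistrib scaleR_matrix_vector_assoc[symmetric])
    next
      show "(A + a *\<^sub>R ?X) $ (vs ! 0) $ (vs ! 1) = 0" using X01 by (simp add: a_def)
    qed
    then have "A = (- a) *\<^sub>R ?X" by (simp add: add_eq_0_iff2)
    then show ?thesis by blast
  qed
  moreover have "?X \<noteq> 0" using X01 by auto
  ultimately show ?thesis using X by (simp add: extremal_def)
qed

text \<open>The upper bound comes from \<open>extremal_support\<close> with the pattern shrunk to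
  the cycle. The supporting cycle found there cannot leave \<open>set vs\<close>, so it is no longer
  than \<open>vs\<close>.\<close>

lemma rank_cycle_matrix:
  fixes E :: "'n::finite set set"
  assumes G: "simple_graph (UNIV, E)" and sp: "series_parallel (UNIV, E)" and C: "chordless_cycle E vs"
  shows "rank (cycle_matrix vs) = length vs - 2"
proof -
  let ?X = "cycle_matrix vs" and ?E = "cycle_edges vs"
  have n: "3 \<le> length vs" and d: "distinct vs" and sub: "?E \<subseteq> E" using C by (auto simp: chordless_cycle_def)
  have edge: "?X $ (vs ! i) $ (vs ! Suc i) \<noteq> 0" if "Suc i < length vs" for i
    using cycle_matrix_edge[OF d n that] by simp
  have ge: "length vs - 2 \<le> rank ?X"
    using rank_ge_of_cycle[OF C cycle_matrix_psd[OF C] edge] .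
  have incl: "e \<subseteq> set vs" if "e \<in> ?E" for e
    using C that unfolding chordless_cycle_def by blast
  have C': "chordless_cycle ?E vs"
    using n d incl by (auto simp: chordless_cycle_def)
  have ext: "extremal ?E ?X" using C' by (rule extremal_cycle_matrix)
  have G': "simple_graph (UNIV, ?E)" using G sub by (auto simp: simple_graph_def)
  have "has_minor (UNIV, E) (UNIV, ?E)" using sub by (intro has_minor_subgraph) auto
  then have sp': "series_parallel (UNIV, ?E)" using series_parallel_minor sp by blast
  have supp: "set vs \<subseteq> {i. ?X $ i $ i \<noteq> 0}"
  proof
    fix v assume "v \<in> set vs"
    then obtain i where i: "i < length vs" "v = vs ! i" by (auto simp: in_set_conv_nth)
    have "?X $ v $ v \<noteq> 0"
    proof (cases "Suc i < length vs")
      case True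
      then show ?thesis using edge i psd_diag_zero(1)[OF cycle_matrix_psd[OF C]] by blast
    next
      case False
      then obtain k where "i = Suc k" "Suc k < length vs" using i n by (cases i) auto
      then show ?thesis using edge i psd_diag_zero(2)[OF cycle_matrix_psd[OF C]] by blast
    qed
    then show "v \<in> {i. ?X $ i $ i \<noteq> 0}" by simp
  qed
  have card: "card (set vs) = length vs" using d by (rule distinct_card)
  have "length vs \<le> card {i. ?X $ i $ i \<noteq> 0}" using supp card card_mono[OF _ supp] by simp
  then obtain us where us: "chordless_cycle ?E us" "{i. ?X $ i $ i \<noteq> 0} \<subseteq> set us"
      "rank ?X \<le> length us - 2"
    using extremal_support[OF G' sp' ext] n by auto
  have "set us \<subseteq> set vs"
  proof
    fix u assume "u \<in> set us"
    then obtain e where "e \<in> ?E" "u \<in> e" by (rule chordless_cycle_vertex_edge[OF us(1)])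
    then show "u \<in> set vs" using incl by blast
  qed
  then have "card (set us) \<le> length vs" using card card_mono[of "set vs" "set us"] by simp
  moreover have "card (set us) = length us"
    using us(1) by (intro distinct_card) (simp add: chordless_cycle_def)
  ultimately show ?thesis using ge us(3) by simp
qed

text \<open>Provides rank one in every graph, even without edges. A matrix below it has zero
  diagonal off \<open>v\<close>, hence one entry only.\<close>

lemma extremal_outer_axis: "extremal E (outer (axis v 1))"
proof -
  let ?X = "outer (axis v 1)"
  have "?X \<in> psd_cone E"
    unfolding psd_cone_iff[of ?X E] using outer_psd by (auto simp: axis_def)
  moreover have "\<exists>k. A = k *\<^sub>R ?X" if A: "A \<in> psd_cone E" "?X - A \<in> psd_cone E" for A
  proof -
    have diag: "A $ i $ i = 0" if "i \<noteq> v" for i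
      using psd_diag_le[OF A, of i] that by (auto simp: axis_def)
    have "A $ i $ j = (A $ v $ v *\<^sub>R ?X) $ i $ j" for i j
      using psd_diag_zero[OF A(1) diag] by (auto simp: axis_def)
    then have "A = A $ v $ v *\<^sub>R ?X" unfolding vec_eq_iff by blast
    then show ?thesis by blast
  qed
  moreover have "?X $ v $ v \<noteq> 0" by simp
  then have "?X \<noteq> 0" by (metis zero_index)
  ultimately show ?thesis by (simp add: extremal_def)
qed

lemma extremal_ranks_series_parallel:
  fixes E :: "'n::finite set set"
  assumes G: "simple_graph (UNIV, E)" and sp: "series_parallel (UNIV, E)"
  shows "extremal_ranks E = {1} \<union> {length vs - 2 | vs. chordless_cycle E vs}"
proof (intro equalityI subsetI)
  fix r assume "r \<in> extremal_ranks E"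
  then obtain X where X: "r = rank X" "extremal E X" by (auto simp: extremal_ranks_eq)
  from extremal_support[OF G sp X(2)]
  consider "card {i. X $ i $ i \<noteq> 0} \<le> 2" | vs where "chordless_cycle E vs"
      "{i. X $ i $ i \<noteq> 0} \<subseteq> set vs" "rank X \<le> length vs - 2" by auto
  then show "r \<in> {1} \<union> {length vs - 2 | vs. chordless_cycle E vs}"
  proof cases
    case 1
    then show ?thesis using extremal_card_le_2_rank[OF X(2)] X(1) by simp
  next
    case 2
    \<comment> \<open>The lower bound of this dichotomy meets the upper bound on the same
      cycle.\<close>
    then have "rank X = 1 \<or> length vs - 2 \<le> rank X"
      by (intro extremal_rank_cycle_cases[OF 2(1) X(2)]) auto
    then show ?thesis using 2 X(1) by auto
  qed
next
  fix r assume "r \<in> {1} \<union> {length vs - 2 | vs. chordless_cycle E vs}"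
  then consider "r = 1" | vs where "r = length vs - 2" "chordless_cycle E vs" by auto
  then show "r \<in> extremal_ranks E"
  proof cases
    case 1
    \<comment> \<open>Any vertex will do; \<open>undefined\<close> names one, as types are
      inhabited.\<close>
    have ext: "extremal E (outer (axis undefined 1))" by (rule extremal_outer_axis)
    have "rank (outer (axis undefined 1) :: real^'n^'n) = 1"
      using extremal_nonzero[OF ext] by (intro rank_outer[of _ 1]) simp_all
    then show ?thesis using 1 ext unfolding extremal_ranks_eq by force
  next
    case 2
    then show ?thesis
      using rank_cycle_matrix[OF G sp 2(2)] extremal_cycle_matrix[OF 2(2)]
      unfolding extremal_ranks_eq by force
  qed
qed


section \<open>Facets of the cut polytope\<close>

text \<open>In 0/1 coordinates the empty cut is the origin, which turns affine spans of cuts through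
  it into linear spans.\<close>

definition cut_indicator :: "'n::finite set set \<Rightarrow> 'n set \<Rightarrow> real ^ ('n set)" where
  "cut_indicator E U = (\<chi> e. if e \<in> cutset E U then 1 else 0)"

definition link_indicator :: "'n::finite set set \<Rightarrow> 'n set \<Rightarrow> 'n set \<Rightarrow> real ^ ('n set)" where
  "link_indicator E A B = (\<chi> e. if e \<in> E \<and> e \<inter> A \<noteq> {} \<and> e \<inter> B \<noteq> {} then 1 else 0)"

lemma card_pair_Int: "x \<noteq> y \<Longrightarrow> card ({x, y} \<inter> U) = 1 \<longleftrightarrow> (x \<in> U) \<noteq> (y \<in> U)"
  by (cases "x \<in> U"; cases "y \<in> U") (auto simp: Int_insert_left)

lemma cut_vector_conv_indicator: "cut_vector E U = cut_vector E {} - 2 *\<^sub>R cut_indicator E U"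
  by (auto simp: vec_eq_iff cut_vector_def cut_indicator_def cutset_def)

lemma cut_vector_nth: "e \<in> E \<Longrightarrow> cut_vector E U $ e = 1 - 2 * cut_indicator E U $ e"
  by (auto simp: cut_vector_def cut_indicator_def)

lemma cut_indicator_outside: "e \<notin> E \<Longrightarrow> cut_indicator E U $ e = 0"
  by (auto simp: cut_indicator_def cutset_def)

lemma cut_indicator_pair:
  "{x, y} \<in> E \<Longrightarrow> x \<noteq> y \<Longrightarrow> cut_indicator E U $ {x, y} = (if (x \<in> U) \<noteq> (y \<in> U) then 1 else 0)"
  using card_pair_Int[of x y U] by (simp add: cut_indicator_def cutset_def)

text \<open>An edge between \<open>A\<close> and \<open>B\<close> lies in both of their cuts but not
  in that of the union; an edge leaving the union is counted once and subtracted once. Tight cuts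
  closed under such unions thus isolate small bundles of edges.\<close>

lemma link_indicator_conv_cuts:
  assumes G: "simple_graph (V, E)" and "A \<inter> B = {}"
  shows "link_indicator E A B =
    (1 / 2) *\<^sub>R (cut_indicator E A + cut_indicator E B - cut_indicator E (A \<union> B))"
proof -
  have "link_indicator E A B $ e =
    (1 / 2) * (cut_indicator E A $ e + cut_indicator E B $ e - cut_indicator E (A \<union> B) $ e)" for e
  proof (cases "e \<in> E")
    case True
    obtain x y where e: "e = {x, y}" "x \<noteq> y" using G True by (rule simple_graphE)
    show ?thesis
      unfolding e(1) cut_indicator_pair[OF True[unfolded e(1)] e(2)]
      using True assms(2) e by (auto simp: link_indicator_def)
  next
    case False
    then show ?thesis by (simp add: cut_indicator_outside link_indicator_def)
  qed
  then show ?thesis by (simp add: vec_eq_iff)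
qed

lemma vec_eq_sum_axis: "(x :: real ^ 'k::finite) = (\<Sum>i\<in>UNIV. (x $ i) *\<^sub>R axis i 1)"
  using basis_expansion[of x] by (simp add: scalar_mult_eq_scaleR)

text \<open>Cuts the computation down to the coordinates in \<open>C\<close> once the unit vectors
  of all others are known to be spanned.\<close>

lemma restrict_in_span:
  fixes x :: "real ^ 'k::finite"
  assumes "x \<in> span S" "\<And>i. i \<notin> C \<Longrightarrow> x $ i \<noteq> 0 \<Longrightarrow> axis i 1 \<in> span S"
  shows "(\<Sum>i\<in>C. (x $ i) *\<^sub>R axis i 1) \<in> span S"
proof -
  have "x = (\<Sum>i\<in>C. (x $ i) *\<^sub>R axis i 1) + (\<Sum>i\<in>- C. (x $ i) *\<^sub>R axis i 1)"
    by (subst vec_eq_sum_axis) (simp add: sum.union_disjoint[symmetric] Compl_partition)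
  then have "(\<Sum>i\<in>C. (x $ i) *\<^sub>R axis i 1) = x - (\<Sum>i\<in>- C. (x $ i) *\<^sub>R axis i 1)"
    by (simp add: algebra_simps)
  moreover have "(x $ i) *\<^sub>R axis i 1 \<in> span S" if "i \<in> - C" for i
    using assms(2)[of i] that by (cases "x $ i = 0") (auto simp: span_zero intro: span_scale)
  ultimately show ?thesis using assms(1) by (auto intro: span_diff span_sum)
qed

text \<open>If one non-tight cut completes the tight cuts to a spanning set, adding that one point
  to the face reaches the dimension of the polytope, so the face has codimension one.\<close>

lemma facet_defining_cut_polytopeI:
  assumes valid: "\<And>U. \<alpha> \<bullet> cut_vector E U \<le> b"
    and base: "\<alpha> \<bullet> cut_vector E {} = b"
    and strict: "\<alpha> \<bullet> cut_vector E W < b"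
    and span: "\<And>e. e \<in> E \<Longrightarrow>
      axis e 1 \<in> span (insert (cut_indicator E W) {cut_indicator E U | U. \<alpha> \<bullet> cut_vector E U = b})"
  shows "facet_defining (cut_polytope E) \<alpha> b"
proof -
  let ?P = "cut_polytope E" and ?c = "cut_vector E"
  let ?S = "insert (cut_indicator E W) {cut_indicator E U | U. \<alpha> \<bullet> ?c U = b}"
  define F where "F = ?P \<inter> {x. \<alpha> \<bullet> x = b}"
  have mem: "?c U \<in> ?P" for U unfolding cut_polytope_def by (rule hull_inc) simp
  have "?P \<subseteq> {x. \<alpha> \<bullet> x \<le> b}" unfolding cut_polytope_def
    using valid by (intro hull_minimal convex_halfspace_le) auto
  then have sub: "\<alpha> \<bullet> x \<le> b" if "x \<in> ?P" for x using that by auto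
  have conv: "convex ?P" unfolding cut_polytope_def by (rule convex_convex_hull)
  have face: "F face_of ?P"
    unfolding F_def using conv sub by (rule face_of_Int_supporting_hyperplane_le)
  have F: "?c U \<in> F" if "\<alpha> \<bullet> ?c U = b" for U using that mem by (simp add: F_def)
  have "?c W \<notin> F" using strict by (simp add: F_def)
  then have "F \<noteq> ?P" using mem by blast
  then have lt: "aff_dim F < aff_dim ?P" by (rule face_of_aff_dim_lt[OF conv face])
  \<comment> \<open>The empty cut already lies in \<open>F\<close>; listing it first makes it the
    base point for describing the affine hull by differences.\<close>
  let ?T = "insert (?c {}) (insert (?c W) F)"
  let ?D = "(\<lambda>x. - ?c {} + x) ` insert (?c W) F"
  have diff: "- ?c {} + ?c U = (- 2) *\<^sub>R cut_indicator E U" for U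
    by (subst cut_vector_conv_indicator) simp
  have ind: "cut_indicator E U \<in> span ?D" if "- ?c {} + ?c U \<in> ?D" for U
  proof -
    have "cut_indicator E U = (- 1 / 2) *\<^sub>R (- ?c {} + ?c U)" unfolding diff by simp
    then show ?thesis using that by (metis span_base span_scale)
  qed
  have "?S \<subseteq> span ?D"
  proof
    fix s assume "s \<in> ?S"
    then obtain U where "s = cut_indicator E U" "?c U \<in> insert (?c W) F" using F by blast
    then show "s \<in> span ?D" using ind by blast
  qed
  then have "span ?S \<subseteq> span ?D" by (rule span_minimal) (rule subspace_span)
  then have ax: "axis e 1 \<in> span ?D" if "e \<in> E" for e using span[OF that] by blast
  have "?c U \<in> affine hull ?T" for U
  proof -
    have "(cut_indicator E U $ e) *\<^sub>R axis e 1 \<in> span ?D" for e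
      using ax[of e] by (cases "e \<in> E") (simp_all add: span_scale cut_indicator_outside span_zero)
    then have "(\<Sum>e\<in>UNIV. (cut_indicator E U $ e) *\<^sub>R axis e 1) \<in> span ?D" by (intro span_sum)
    then have "cut_indicator E U \<in> span ?D" by (simp flip: vec_eq_sum_axis)
    then have "- ?c {} + ?c U \<in> span ?D" unfolding diff by (rule span_scale)
    moreover have "?c U = ?c {} + (- ?c {} + ?c U)" by simp
    ultimately show ?thesis unfolding affine_hull_insert_span_gen by blast
  qed
  then have "?P \<subseteq> affine hull ?T"
    unfolding cut_polytope_def
    by (intro hull_minimal affine_imp_convex affine_affine_hull) auto
  then have "aff_dim ?P \<le> aff_dim ?T" by (metis aff_dim_affine_hull aff_dim_subset)
  also have "?T = insert (?c W) F" using F[OF base] by auto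
  also have "aff_dim \<dots> \<le> aff_dim F + 1" by (simp add: aff_dim_insert)
  finally have "aff_dim F = aff_dim ?P - 1" using lt by simp
  then have "F facet_of ?P" using face F[OF base] by (auto simp: facet_of_def)
  then show ?thesis using sub by (auto simp: facet_defining_def F_def)
qed

text \<open>Tight cuts keep \<open>u\<close> and \<open>v\<close> together, so they are the cuts of
  the graph with \<open>uv\<close> contracted. Without a triangle on \<open>uv\<close> this
  contraction identifies no two edges, and every other edge can be isolated.\<close>

lemma facet_defining_edge:
  assumes G: "simple_graph (V, E)" and uv: "{u, v} \<in> E"
    and no_triangle: "\<And>w. {u, w} \<in> E \<Longrightarrow> {v, w} \<notin> E"
  shows "facet_defining (cut_polytope E) (axis {u, v} 1) 1"
proof (rule facet_defining_cut_polytopeI)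
  have neq: "u \<noteq> v" using simple_graph_pair_neq[OF G uv] .
  let ?e = "{u, v}"
  have val: "axis ?e 1 \<bullet> cut_vector E U = (if (u \<in> U) \<noteq> (v \<in> U) then - 1 else 1)" for U
    using cut_vector_nth[OF uv] cut_indicator_pair[OF uv neq] by (simp add: inner_axis')
  show "axis ?e 1 \<bullet> cut_vector E U \<le> 1" for U unfolding val by simp
  show "axis ?e 1 \<bullet> cut_vector E {} = 1" unfolding val by simp
  show "axis ?e 1 \<bullet> cut_vector E {u} < 1" unfolding val using neq by simp
  let ?S = "insert (cut_indicator E {u}) {cut_indicator E U | U. axis ?e 1 \<bullet> cut_vector E U = 1}"
  have cut: "cut_indicator E U \<in> span ?S" if "u \<in> U \<longleftrightarrow> v \<in> U" for U
    using that by (intro span_base) (auto simp: val)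
  have other: "axis f 1 \<in> span ?S" if f: "f \<in> E" "f \<noteq> ?e" for f
  proof -
    obtain a b where ab: "f = {a, b}" "a \<noteq> b" using G f(1) by (rule simple_graphE)
    define A where "A = (if a \<in> ?e then ?e else {a})"
    define B where "B = (if b \<in> ?e then ?e else {b})"
    have not_both: "\<not> (a \<in> ?e \<and> b \<in> ?e)" using ab f(2) by auto
    then have disj: "A \<inter> B = {}" using ab(2) by (auto simp: A_def B_def)
    have link: "link_indicator E A B \<in> span ?S"
      unfolding link_indicator_conv_cuts[OF G disj]
      by (intro span_scale span_diff span_add cut) (auto simp: A_def B_def)
    \<comment> \<open>A second edge between the blocks would join the same outside vertex to both
      \<open>u\<close> and \<open>v\<close>.\<close>
    have only: "e = f" if e: "e \<in> E" "e \<inter> A \<noteq> {}" "e \<inter> B \<noteq> {}" for e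
    proof -
      obtain p q where pq: "e = {p, q}" "p \<in> A" "q \<in> B"
      proof -
        obtain x y where xy: "e = {x, y}" using G e(1) by (rule simple_graphE)
        obtain p q where "p \<in> e" "p \<in> A" "q \<in> e" "q \<in> B" using e by blast
        moreover from this have "p \<noteq> q" using disj by auto
        ultimately show ?thesis using that xy by (metis insertE insert_commute singletonD)
      qed
      have tri: "{u, w} \<notin> E \<or> {v, w} \<notin> E" "{w, u} \<notin> E \<or> {w, v} \<notin> E" for w
        using no_triangle[of w] by (auto simp: insert_commute)
      show ?thesis
      proof (cases "a \<in> ?e")
        case True
        then have "q = b" "p \<in> ?e" using pq not_both by (auto simp: A_def B_def)
        then show ?thesis using True tri(1)[of b] pq(1) e(1) f(1) ab(1) by auto
      next
        case False
        then have "p = a" using pq by (simp add: A_def)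
        show ?thesis
        proof (cases "b \<in> ?e")
          case True
          then have "q \<in> ?e" using pq by (simp add: B_def)
          then show ?thesis using True tri(2)[of a] pq(1) e(1) f(1) ab(1) \<open>p = a\<close> by auto
        next
          case False
          then show ?thesis using pq \<open>p = a\<close> ab(1) by (simp add: B_def)
        qed
      qed
    qed
    have "f \<inter> A \<noteq> {}" "f \<inter> B \<noteq> {}" using ab(1) by (auto simp: A_def B_def)
    then have "e \<in> E \<and> e \<inter> A \<noteq> {} \<and> e \<inter> B \<noteq> {} \<longleftrightarrow> e = f" for e using only f(1) by blast
    then have "link_indicator E A B = axis f 1" by (simp only: link_indicator_def axis_def)
    then show ?thesis using link by simp
  qed
  fix e assume "e \<in> E"
  show "axis e 1 \<in> span ?S"
  proof (cases "e = ?e")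
    case True
    have "cut_indicator E {u} \<in> span ?S" by (intro span_base) simp
    then have "(\<Sum>i\<in>{?e}. (cut_indicator E {u} $ i) *\<^sub>R axis i 1) \<in> span ?S"
      using other cut_indicator_outside[of _ E] by (intro restrict_in_span) auto
    then show ?thesis using True cut_indicator_pair[OF uv neq, of "{u}"] neq by simp
  qed (use other \<open>e \<in> E\<close> in auto)
qed

text \<open>The tight cuts used meet the cycle in an initial segment of the list and are arbitrary
  off the cycle. This freedom yields the unit vectors of all edges outside the cycle, after which
  only cycle coordinates matter.\<close>

lemma facet_defining_cycle:
  fixes E :: "'n::finite set set"
  assumes G: "simple_graph (V, E)" and C: "chordless_cycle E vs"
  shows "facet_defining (cut_polytope E)
    ((\<Sum>e\<in>cycle_edges vs - {{last vs, hd vs}}. axis e 1) - (\<Sum>e\<in>{{last vs, hd vs}}. axis e 1))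
    (real (length vs) - 2)"
    (is "facet_defining _ ?\<alpha> ?b")
proof -
  let ?n = "length vs"
  have n: "3 \<le> ?n" and d: "distinct vs" and sub: "cycle_edges vs \<subseteq> E"
    and ind: "{e \<in> E. e \<subseteq> set vs} = cycle_edges vs"
    using C by (auto simp: chordless_cycle_def)
  have ne: "vs \<noteq> []" using n by auto
  have pos: "0 < ?n" using n by linarith
  have idx: "vs ! i = vs ! j \<longleftrightarrow> i = j" if "i < ?n" "j < ?n" for i j
    using nth_eq_iff_index_eq[OF d that] .
  define e1 where "e1 = {vs ! (?n - 1), vs ! 0}"
  define p where "p i = {vs ! i, vs ! Suc i}" for i
  have e1: "{last vs, hd vs} = e1" using ne by (simp add: e1_def last_conv_nth hd_conv_nth)
  have path: "path_edges vs = p ` {..<?n - 1}" by (auto simp: path_edges_def p_def)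
  have notin: "e1 \<notin> p ` {..<?n - 1}"
    using closing_edge_notin_path_edges[OF d n] unfolding e1 path .
  have ce: "cycle_edges vs = insert e1 (p ` {..<?n - 1})"
    unfolding cycle_edges_conv_path_edges[OF ne] e1 path ..
  have inj: "inj_on p {..<?n - 1}"
  proof (rule inj_onI)
    fix i j assume "i \<in> {..<?n - 1}" "j \<in> {..<?n - 1}" "p i = p j"
    then show "i = j" by (auto simp: p_def doubleton_eq_iff idx)
  qed
  have pE: "p i \<in> E" if "i < ?n - 1" for i using sub that unfolding ce by auto
  have e1_in: "e1 \<in> E" using sub unfolding ce by auto
  have alpha: "?\<alpha> = (\<Sum>i<?n - 1. axis (p i) 1) - axis e1 1"
  proof -
    have "cycle_edges vs - {e1} = p ` {..<?n - 1}" using notin unfolding ce by auto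
    then show ?thesis unfolding e1 by (simp add: sum.reindex[OF inj] o_def del: One_nat_def)
  qed
  have e1_neq: "vs ! (?n - 1) \<noteq> vs ! 0" using idx[of "?n - 1" 0] n pos by simp
  have t1: "cut_indicator E U $ e1 = (if (vs ! (?n - 1) \<in> U) \<noteq> (vs ! 0 \<in> U) then 1 else 0)" for U
    using cut_indicator_pair[OF e1_in[unfolded e1_def] e1_neq] by (simp add: e1_def)
  have tp: "cut_indicator E U $ p i = (if (vs ! i \<in> U) \<noteq> (vs ! Suc i \<in> U) then 1 else 0)"
    if "i < ?n - 1" for U i
    using cut_indicator_pair[of "vs ! i" "vs ! Suc i" E U] pE[OF that] idx[of i "Suc i"] that
    by (simp add: p_def)
  \<comment> \<open>The slack is twice the number of cut path edges, minus twice the indicator of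
    the closing edge. The empty cut gives (m - 1) - 1 = m - 2.\<close>
  have val: "?\<alpha> \<bullet> cut_vector E U =
      ?b - 2 * ((\<Sum>i<?n - 1. cut_indicator E U $ p i) - cut_indicator E U $ e1)" for U
  proof -
    have "(\<Sum>i<?n - 1. cut_vector E U $ p i) = (\<Sum>i<?n - 1. 1 - 2 * cut_indicator E U $ p i)"
      using pE by (intro sum.cong) (auto simp: cut_vector_nth)
    also have "\<dots> = real (?n - 1) - 2 * (\<Sum>i<?n - 1. cut_indicator E U $ p i)"
      by (simp add: sum_subtractf sum_distrib_left)
    finally show ?thesis
      unfolding alpha using cut_vector_nth[OF e1_in, of U] n
      by (simp add: inner_diff_left inner_sum_left inner_axis' of_nat_diff)
  qed
  have tight: "?\<alpha> \<bullet> cut_vector E U = ?b"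
    if k: "k \<le> ?n" and U: "\<And>i. i < ?n \<Longrightarrow> vs ! i \<in> U \<longleftrightarrow> i < k" for U k
  proof -
    have "cut_indicator E U $ p i = (if Suc i = k then 1 else 0)" if "i < ?n - 1" for i
      using tp[OF that] U[of i] U[of "Suc i"] that by auto
    then have "(\<Sum>i<?n - 1. cut_indicator E U $ p i) = (\<Sum>i<?n - 1. if Suc i = k then 1 else 0)"
      by (intro sum.cong) auto
    also have "\<dots> = (if 0 < k \<and> k < ?n then 1 else 0)"
      using k by (cases k) auto
    also have "\<dots> = cut_indicator E U $ e1"
      unfolding t1 using U[of 0] U[of "?n - 1"] pos k by auto
    finally show ?thesis unfolding val by simp
  qed
  let ?W = "{vs ! 1}"
  let ?S = "insert (cut_indicator E ?W) {cut_indicator E U | U. ?\<alpha> \<bullet> cut_vector E U = ?b}"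
  define T where "T = ?S"
  have arc: "cut_indicator E U \<in> span T"
    if "k \<le> ?n" "\<And>i. i < ?n \<Longrightarrow> vs ! i \<in> U \<longleftrightarrow> i < k" for U k
    using tight[OF that] unfolding T_def by (intro span_base) blast
  define A where "A k = (\<lambda>i. vs ! i) ` {..<k}" for k
  have A: "vs ! i \<in> A k \<longleftrightarrow> i < k" if "i < ?n" "k \<le> ?n" for i k
    using that idx by (auto simp: A_def)
  have A_sub: "A k \<subseteq> set vs" if "k \<le> ?n" for k using that by (auto simp: A_def)
  have link: "link_indicator E (A k) {b} \<in> span T" if "k \<le> ?n" "b \<notin> set vs" for k b
  proof -
    have disj: "A k \<inter> {b} = {}" using A_sub that by auto
    have b: "vs ! i \<noteq> b" if "i < ?n" for i using that \<open>b \<notin> set vs\<close> by (metis nth_mem)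
    show ?thesis
      unfolding link_indicator_conv_cuts[OF G disj]
      using A that b
      by (intro span_scale span_diff span_add arc[of k] arc[of 0 "{b}"] arc[of k "A k \<union> {b}"]) auto
  qed
  have mixed: "axis {vs ! i, b} 1 \<in> span T" if i: "i < ?n" and b: "b \<notin> set vs" "{vs ! i, b} \<in> E" for i b
  proof -
    \<comment> \<open>Consecutive initial segments differ in one vertex, so their links to
      \<open>b\<close> differ in one edge.\<close>
    have "axis {vs ! i, b} 1 = link_indicator E (A (Suc i)) {b} - link_indicator E (A i) {b}"
    proof -
      have AS: "A (Suc i) = insert (vs ! i) (A i)" by (auto simp: A_def lessThan_Suc)
      have nA: "vs ! i \<notin> A i" using A[of i i] i by simp
      have bA: "b \<notin> A (Suc i)" "b \<noteq> vs ! i" using A_sub[of "Suc i"] b i by auto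
      have "(if e = {vs ! i, b} then 1 else 0 :: real) =
        link_indicator E (A (Suc i)) {b} $ e - link_indicator E (A i) {b} $ e" for e
      proof (cases "e \<in> E \<and> b \<in> e")
        case True
        obtain x y where "e = {x, y}" using simple_graphE[OF G] True by metis
        then obtain z where z: "e = {z, b}" using True by auto
        have "z \<noteq> b" using simple_graph_pair_neq[OF G] True z by blast
        then show ?thesis using True z AS nA bA by (auto simp: link_indicator_def doubleton_eq_iff)
      next
        case False
        then show ?thesis using b by (auto simp: link_indicator_def)
      qed
      then show ?thesis by (simp add: vec_eq_iff axis_def)
    qed
    then show ?thesis using link[of "Suc i" b] link[of i b] i b by (simp add: span_diff)
  qed
  have off: "axis f 1 \<in> span T" if f: "f \<in> E" "f \<notin> cycle_edges vs" for f
  proof -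
    obtain a b where ab: "f = {a, b}" "a \<noteq> b" using G f(1) by (rule simple_graphE)
    \<comment> \<open>Chordlessness enters here: an edge off the cycle has an end off the
      cycle.\<close>
    have "\<not> f \<subseteq> set vs" using f ind by blast
    then consider "a \<notin> set vs" "b \<notin> set vs" | "a \<in> set vs" "b \<notin> set vs" | "b \<in> set vs" "a \<notin> set vs"
      using ab(1) by auto
    then show ?thesis
    proof cases
      case 1
      have disj: "{a} \<inter> {b} = {}" using ab(2) by simp
      have nth: "vs ! i \<noteq> a" "vs ! i \<noteq> b" if "i < ?n" for i using 1 nth_mem[OF that] by auto
      have "link_indicator E {a} {b} \<in> span T"
        unfolding link_indicator_conv_cuts[OF G disj]
        using nth by (intro span_scale span_diff span_add arc[of 0]) auto
      moreover have "link_indicator E {a} {b} = axis f 1"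
      proof -
        have "e = f" if e: "e \<in> E" "a \<in> e" "b \<in> e" for e
        proof -
          obtain x y where "e = {x, y}" using G e(1) by (rule simple_graphE)
          then show ?thesis using e ab by auto
        qed
        then have "e \<in> E \<and> e \<inter> {a} \<noteq> {} \<and> e \<inter> {b} \<noteq> {} \<longleftrightarrow> e = f" for e using f(1) ab(1) by blast
        then show ?thesis by (simp only: link_indicator_def axis_def)
      qed
      ultimately show ?thesis by simp
    next
      case 2
      then show ?thesis using mixed[of _ b] f(1) ab(1) by (auto simp: in_set_conv_nth)
    next
      case 3
      then show ?thesis using mixed[of _ a] f(1) ab(1) by (auto simp: in_set_conv_nth insert_commute)
    qed
  qed
  have restrict: "(cut_indicator E U $ e1) *\<^sub>R axis e1 1 +
      (\<Sum>i<?n - 1. (cut_indicator E U $ p i) *\<^sub>R axis (p i) 1) \<in> span T"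
    if "cut_indicator E U \<in> span T" for U
  proof -
    have "(\<Sum>e\<in>cycle_edges vs. (cut_indicator E U $ e) *\<^sub>R axis e 1) \<in> span T"
      using that off cut_indicator_outside[of _ E U] by (intro restrict_in_span) blast+
    then show ?thesis
      unfolding ce using notin by (simp add: sum.reindex[OF inj] o_def del: One_nat_def)
  qed
  \<comment> \<open>The segment ending at \<open>vs ! i\<close> cuts exactly the closing edge and
    \<open>p i\<close>.\<close>
  have pair: "axis e1 1 + axis (p i) 1 \<in> span T" if i: "i < ?n - 1" for i
  proof -
    have k: "Suc i \<le> ?n" using i by simp
    have "cut_indicator E (A (Suc i)) \<in> span T" using A k by (intro arc[OF k]) blast
    from restrict[OF this]
    have "(cut_indicator E (A (Suc i)) $ e1) *\<^sub>R axis e1 1 +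
      (\<Sum>j<?n - 1. (cut_indicator E (A (Suc i)) $ p j) *\<^sub>R axis (p j) 1) \<in> span T" .
    moreover have "cut_indicator E (A (Suc i)) $ e1 = 1"
      unfolding t1 using A[of 0 "Suc i"] A[of "?n - 1" "Suc i"] i pos by auto
    moreover have "(\<Sum>j<?n - 1. (cut_indicator E (A (Suc i)) $ p j) *\<^sub>R axis (p j) 1) =
        (\<Sum>j<?n - 1. if j = i then axis (p i) (1::real) else 0)"
      using k A by (intro sum.cong) (auto simp: tp)
    ultimately show ?thesis using i by simp
  qed
  have W: "cut_indicator E ?W $ e1 = 0" "cut_indicator E ?W $ p 0 = 1" "cut_indicator E ?W $ p 1 = 1"
    "\<And>i. 1 < i \<Longrightarrow> i < ?n - 1 \<Longrightarrow> cut_indicator E ?W $ p i = 0"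
    using n pos idx[of _ 1] by (auto simp: t1 tp)
  have split: "{..<?n - 1} = {0, 1} \<union> {2..<?n - 1}" using n by auto
  have "cut_indicator E ?W \<in> span T" unfolding T_def by (intro span_base) simp
  from restrict[OF this]
  have W_in: "axis (p 0) 1 + axis (p 1) 1 \<in> span T"
    unfolding split using W by (subst (asm) sum.union_disjoint) auto
  \<comment> \<open>\<open>?W\<close> cuts \<open>p 0\<close> and \<open>p 1\<close> but not the
    closing edge. Together with the two pairs containing \<open>e1\<close> this gives an odd cycle
    of sums, which can be solved for each summand.\<close>
  have "(axis (p 0) 1 :: real ^ ('n set)) = (1 / 2) *\<^sub>R
      (axis (p 0) 1 + axis (p 1) 1 + (axis e1 1 + axis (p 0) 1) - (axis e1 1 + axis (p 1) 1))"
    by (simp add: vec_eq_iff)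
  moreover have "axis (p 0) 1 + axis (p 1) 1 + (axis e1 1 + axis (p 0) 1) -
      (axis e1 1 + axis (p 1) 1) \<in> span T"
    by (rule span_diff[OF span_add[OF W_in pair] pair]) (use n in linarith)+
  ultimately have p0: "axis (p 0) 1 \<in> span T" using span_scale by metis
  have e1S: "axis e1 1 \<in> span T" using span_diff[OF pair[of 0] p0] n by simp
  have pS: "axis (p i) 1 \<in> span T" if "i < ?n - 1" for i
    using span_diff[OF pair[OF that] e1S] by simp
  show ?thesis
  proof (rule facet_defining_cut_polytopeI)
    fix U
    \<comment> \<open>If no path edge is cut, walking along the path keeps all its vertices on one
      side, so the closing edge is not cut either.\<close>
    have "cut_indicator E U $ e1 \<le> (\<Sum>i<?n - 1. cut_indicator E U $ p i)"
    proof (cases "\<exists>i<?n - 1. cut_indicator E U $ p i = 1")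
      case True
      then obtain i where "i < ?n - 1" "cut_indicator E U $ p i = 1" by blast
      then have "1 \<le> (\<Sum>i<?n - 1. cut_indicator E U $ p i)"
        using member_le_sum[of i "{..<?n - 1}" "\<lambda>i. cut_indicator E U $ p i"] by (simp add: tp)
      then show ?thesis by (simp add: t1)
    next
      case False
      have "vs ! i \<in> U \<longleftrightarrow> vs ! 0 \<in> U" if "i < ?n" for i
        using that
      proof (induction i)
        case (Suc i)
        then have "cut_indicator E U $ p i \<noteq> 1" using False by auto
        then show ?case using Suc tp[of i U] by (auto split: if_splits)
      qed simp
      from this[of "?n - 1"] have "vs ! (?n - 1) \<in> U \<longleftrightarrow> vs ! 0 \<in> U" using pos by linarith
      then have "cut_indicator E U $ e1 = 0" unfolding t1 by simp
      moreover have "0 \<le> (\<Sum>i<?n - 1. cut_indicator E U $ p i)" by (intro sum_nonneg) (simp add: tp)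
      ultimately show ?thesis by simp
    qed
    then show "?\<alpha> \<bullet> cut_vector E U \<le> ?b" unfolding val by simp
  next
    show "?\<alpha> \<bullet> cut_vector E {} = ?b" by (rule tight[of 0]) auto
    have "(\<Sum>i<?n - 1. cut_indicator E ?W $ p i) = 2"
      unfolding split using W by (subst sum.union_disjoint) auto
    then show "?\<alpha> \<bullet> cut_vector E ?W < ?b" unfolding val using W by simp
  next
    fix e assume "e \<in> E"
    have "axis e 1 \<in> span T"
    proof (cases "e \<in> cycle_edges vs")
      case True
      then consider "e = e1" | i where "i < ?n - 1" "e = p i" unfolding ce by auto
      then show ?thesis using e1S pS by cases simp_all
    qed (use off \<open>e \<in> E\<close> in auto)
    then show "axis e 1 \<in> span ?S" unfolding T_def .
  qed
qed

text \<open>One inclusion is read off from the listed inequalities. For the other, an edge in a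
  triangle gives no facet, since its inequality is the mean of two triangle inequalities; but then
  the triangle itself supplies 3 - 2 = 1.\<close>

lemma facet_constant_terms_eq:
  assumes G: "simple_graph (V, E)" and "E \<noteq> {}"
  shows "facet_constant_terms E = {1} \<union> {real (length vs) - 2 | vs. chordless_cycle E vs}"
proof (intro equalityI subsetI)
  fix b assume "b \<in> facet_constant_terms E"
  then show "b \<in> {1} \<union> {real (length vs) - 2 | vs. chordless_cycle E vs}"
    by (auto simp: facet_constant_terms_def edge_inequality_def cycle_inequality_def)
next
  have cycle: "real (length vs) - 2 \<in> facet_constant_terms E" if C: "chordless_cycle E vs" for vs
  proof -
    have "vs \<noteq> []" using C by (auto simp: chordless_cycle_def)
    then have "{{last vs, hd vs}} \<subseteq> cycle_edges vs" by (simp add: cycle_edges_conv_path_edges)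
    then have "cycle_inequality E
      ((\<Sum>e\<in>cycle_edges vs - {{last vs, hd vs}}. axis e 1) - (\<Sum>e\<in>{{last vs, hd vs}}. axis e 1))
      (real (length vs) - 2)"
      unfolding cycle_inequality_def
      using C by (intro exI[of _ vs] exI[of _ "{{last vs, hd vs}}"]) simp
    then show ?thesis
      using facet_defining_cycle[OF G C] unfolding facet_constant_terms_def by blast
  qed
  have one: "1 \<in> facet_constant_terms E"
  proof -
    obtain e where e: "e \<in> E" using assms(2) by auto
    obtain u v where uv: "e = {u, v}" using G e by (rule simple_graphE)
    show ?thesis
    proof (cases "\<exists>w. {u, w} \<in> E \<and> {v, w} \<in> E")
      case True
      then obtain w where "{v, w} \<in> E" "{u, w} \<in> E" by blast
      then have "chordless_cycle E [u, v, w]" using chordless_triangle[OF G] e uv by blast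
      from cycle[OF this] show ?thesis by simp
    next
      case False
      then have "facet_defining (cut_polytope E) (axis e 1) 1"
        using facet_defining_edge[OF G] e unfolding uv by blast
      moreover have "edge_inequality E (axis e 1) 1" using e by (auto simp: edge_inequality_def)
      ultimately show ?thesis unfolding facet_constant_terms_def by blast
    qed
  qed
  fix b assume "b \<in> {1} \<union> {real (length vs) - 2 | vs. chordless_cycle E vs}"
  then show "b \<in> facet_constant_terms E" using one cycle by blast
qed

theorem theorem1p4:
  fixes E :: "'n::finite set set"
  assumes "simple_graph (UNIV, E)"
    and "series_parallel (UNIV, E)"
  shows "(E \<noteq> {} \<longrightarrow> facet_constant_terms E = real ` extremal_ranks E) \<and>
         extremal_ranks E = {1} \<union> {length vs - 2 | vs. chordless_cycle E vs} \<and>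
         ((\<exists>vs. chordless_cycle E vs) \<longrightarrow>
            sparsity_order E = Max {length vs | vs. chordless_cycle E vs} - 2)"
proof (intro conjI impI)
  let ?L = "{length vs | vs. chordless_cycle E vs}"
  have len: "3 \<le> length vs" if "chordless_cycle E vs" for vs
    using that by (simp add: chordless_cycle_def)
  have image: "{length vs - 2 | vs. chordless_cycle E vs} = (\<lambda>l. l - 2) ` ?L" by auto
  show ranks: "extremal_ranks E = {1} \<union> {length vs - 2 | vs. chordless_cycle E vs}"
    using assms by (rule extremal_ranks_series_parallel)
  show "facet_constant_terms E = real ` extremal_ranks E" if "E \<noteq> {}"
  proof -
    \<comment> \<open>Truncated subtraction agrees with real subtraction because cycles have length
      at least three.\<close>
    have "real ` (\<lambda>l. l - 2) ` ?L = (\<lambda>l. real l - 2) ` ?L"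
      unfolding image_image using len by (intro image_cong) fastforce+
    then show ?thesis
      unfolding facet_constant_terms_eq[OF assms(1) that] ranks image image_Un by auto
  qed
  assume "\<exists>vs. chordless_cycle E vs"
  then have ne: "?L \<noteq> {}" by auto
  have "length vs \<le> CARD('n)" if "chordless_cycle E vs" for vs
    using that card_mono[of UNIV "set vs"] by (simp add: chordless_cycle_def distinct_card)
  then have "?L \<subseteq> {..CARD('n)}" by auto
  then have fin: "finite ?L" by (rule finite_subset) simp
  \<comment> \<open>Makes the longest cycle contribute at least 1, so the extra rank 1 does not
    affect the maximum.\<close>
  have "3 \<le> Max ?L" using Max_in[OF fin ne] len by auto
  moreover have "Max ((\<lambda>l. l - 2) ` ?L) = Max ?L - 2"
    using fin ne by (intro mono_Max_commute[symmetric]) (auto simp: mono_def)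
  ultimately show "sparsity_order E = Max ?L - 2"
    unfolding sparsity_order_def ranks image using fin ne by (simp add: Max_insert)
qed

end
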